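(* If $u\in W_0^{1,1}(\Omega)$ is a nonnegative function such that $$\int_\Omega\frac{u}{d_{\partial\Omega}^2}<\infty,$$ then $\partial u/\partial n=0$ almost everywhere on $\partial\Omega$ (with respect to the surface measure).
   Context: $\Omega\subset\mathbb{R}^N$ ($N\ge1$) is a smooth bounded connected open set, $n$ is the outward unit normal, $\sigma=\mathcal{H}^{N-1}\lfloor_{\partial\Omega}$ is the surface measure of $\partial\Omega$, and $d_{\partial\Omega}:\overline\Omega\to\mathbb{R}$ is the distance to $\partial\Omega$. Distributional normal derivative: if $w\in W_0^{1,1}(\Omega)$ and the distribution $\Delta w$ is a finite (signed Borel) measure in $\Omega$, then it is known that there is a unique function $\partial w/\partial n\in L^1(\partial\Omega)$ such that $\int_\Omega\nabla w\cdot\nabla\psi=-\int_\Omega\psi\,d(\Delta w)+\int_{\partial\Omega}\psi\,\frac{\partial w}{\partial n}\,d\sigma$ for every $\psi\in C^\infty(\overline\Omega)$. Normal derivative of a general $u\in W_0^{1,1}(\Omega)$: let $\mathcal{G}_u$ be the set of $w\in W_0^{1,1}(\Omega)$ such that $\Delta w$ is a finite measure in $\Omega$ and $w\le u$ a.e. in $\Omega$. Then $\partial u/\partial n$ is the essential infimum of $\{\partial w/\partial n:w\in\mathcal{G}_u\}$, i.e. the ($\sigma$-a.e. unique) Borel function $F:\partial\Omega\to[-\infty,\infty]$ such that (i) $F\le\partial w/\partial n$ a.e. on $\partial\Omega$ for every $w\in\mathcal{G}_u$, and (ii) any Borel function $\widetilde F:\partial\Omega\to[-\infty,\infty]$ satisfying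 (i) satisfies $\widetilde F\le F$ a.e. on $\partial\Omega$. *)

theory Defs
  imports "HOL-Analysis.Analysis"
begin

text \<open>The factor \<^const>\<open>unit_ball_vol\<close> normalises the measure so that it is the usual surface area;
  for \<open>s = 0\<close> it is the counting measure (\<open>0 ^ 0 = 1\<close>, hence the case distinction on \<open>C\<close>).\<close>

definition hausdorff_gauge :: "nat \<Rightarrow> 'a::metric_space set \<Rightarrow> ennreal" where
  "hausdorff_gauge s C =
     (if C = {} then 0 else ennreal (unit_ball_vol (real s) * (diameter C / 2) ^ s))"

text \<open>Boundedness is required explicitly because \<^const>\<open>diameter\<close> is unspecified on unbounded sets.\<close>

definition hausdorff_covers :: "real \<Rightarrow> 'a::metric_space set \<Rightarrow> (nat \<Rightarrow> 'a set) set" where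
  "hausdorff_covers \<delta> A =
     {C. A \<subseteq> (\<Union>i. C i) \<and> (\<forall>i. bounded (C i) \<and> diameter (C i) \<le> \<delta>)}"

definition hausdorff_pre :: "nat \<Rightarrow> real \<Rightarrow> 'a::metric_space set \<Rightarrow> ennreal" where
  "hausdorff_pre s \<delta> A = (INF C\<in>hausdorff_covers \<delta> A. \<Sum>i. hausdorff_gauge s (C i))"

definition hausdorff_outer :: "nat \<Rightarrow> 'a::metric_space set \<Rightarrow> ennreal" where
  "hausdorff_outer s A = (SUP \<delta>\<in>{0<..}. hausdorff_pre s \<delta> A)"

text \<open>\<^const>\<open>measure_of\<close> yields the null measure unless its argument is countably additive;
  lemma \<open>emeasure_hausdorff_measure\<close> below shows that this does not happen.\<close>

definition hausdorff_measure :: "nat \<Rightarrow> 'a::metric_space measure" where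
  "hausdorff_measure s = measure_of UNIV (sets borel) (hausdorff_outer s)"

definition surface_measure :: "'a::euclidean_space set \<Rightarrow> 'a measure" where
  "surface_measure \<Omega> = restrict_space (hausdorff_measure (DIM('a) - 1)) (frontier \<Omega>)"

lemma hausdorff_gauge_empty [simp]: "hausdorff_gauge s {} = 0"
  by (simp add: hausdorff_gauge_def)

lemma hausdorff_pre_empty [simp]:
  assumes "0 < \<delta>"
  shows "hausdorff_pre s \<delta> ({} :: 'a::metric_space set) = 0"
proof -
  from assms have "(\<lambda>_. {}) \<in> hausdorff_covers \<delta> ({}::'a set)"
    by (auto simp: hausdorff_covers_def)
  then have "hausdorff_pre s \<delta> ({}::'a set) \<le> (\<Sum>i::nat. hausdorff_gauge s ({}::'a set))"
    unfolding hausdorff_pre_def by (rule INF_lower)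
  then show ?thesis by simp
qed

lemma hausdorff_outer_empty [simp]: "hausdorff_outer s {} = 0"
  by (auto simp: hausdorff_outer_def intro!: antisym SUP_least)

lemma hausdorff_pre_mono: "A \<subseteq> B \<Longrightarrow> hausdorff_pre s \<delta> A \<le> hausdorff_pre s \<delta> B"
  unfolding hausdorff_pre_def by (rule INF_superset_mono) (auto simp: hausdorff_covers_def)

lemma hausdorff_pre_antimono: "\<delta> \<le> \<epsilon> \<Longrightarrow> hausdorff_pre s \<epsilon> A \<le> hausdorff_pre s \<delta> A"
  unfolding hausdorff_pre_def
  by (rule INF_superset_mono) (auto simp: hausdorff_covers_def intro: order_trans)

lemma hausdorff_outer_mono: "A \<subseteq> B \<Longrightarrow> hausdorff_outer s A \<le> hausdorff_outer s B"
  unfolding hausdorff_outer_def by (rule SUP_mono) (auto intro: hausdorff_pre_mono)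

lemma hausdorff_pre_le_outer: "0 < \<delta> \<Longrightarrow> hausdorff_pre s \<delta> A \<le> hausdorff_outer s A"
  unfolding hausdorff_outer_def by (rule SUP_upper) auto

lemma hausdorff_pre_UN:
  assumes "0 < \<delta>"
  shows "hausdorff_pre s \<delta> (\<Union>i::nat. A i) \<le> (\<Sum>i. hausdorff_pre s \<delta> (A i))"
proof (rule ennreal_le_epsilon)
  fix e :: real
  assume fin: "(\<Sum>i. hausdorff_pre s \<delta> (A i)) < top" and e: "0 < e"
  have "\<exists>C\<in>hausdorff_covers \<delta> (A i).
      (\<Sum>j. hausdorff_gauge s (C j)) \<le> hausdorff_pre s \<delta> (A i) + ennreal (e * (1/2)^Suc i)" for i
  proof (rule ccontr)
    assume "\<not> ?thesis"
    then have "hausdorff_pre s \<delta> (A i) + ennreal (e * (1/2)^Suc i) \<le> hausdorff_pre s \<delta> (A i)"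
      unfolding hausdorff_pre_def[of s \<delta> "A i"]
      by (intro INF_greatest) (auto simp: not_le hausdorff_pre_def less_imp_le)
    moreover have "hausdorff_pre s \<delta> (A i) < top"
      using fin by (rule ennreal_suminf_lessD)
    moreover have "0 < ennreal (e * (1/2)^Suc i)"
      using e by simp
    ultimately show False
      using ennreal_add_left_cancel_le[of "hausdorff_pre s \<delta> (A i)" "ennreal (e * (1/2)^Suc i)" 0]
      by (simp add: less_le_not_le del: power_Suc)
  qed
  then obtain C where C: "\<And>i. C i \<in> hausdorff_covers \<delta> (A i)"
    and le: "\<And>i. (\<Sum>j. hausdorff_gauge s (C i j))
      \<le> hausdorff_pre s \<delta> (A i) + ennreal (e * (1/2)^Suc i)"
    by metis
  let ?D = "\<lambda>k. C (fst (prod_decode k)) (snd (prod_decode k))"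
  have "(\<Union>i. A i) \<subseteq> (\<Union>k. ?D k)"
  proof
    fix x assume "x \<in> (\<Union>i. A i)"
    then obtain i where "x \<in> A i" by auto
    with C[of i] obtain j where "x \<in> C i j" by (auto simp: hausdorff_covers_def)
    then have "x \<in> ?D (prod_encode (i, j))" by simp
    then show "x \<in> (\<Union>k. ?D k)" by blast
  qed
  then have "?D \<in> hausdorff_covers \<delta> (\<Union>i. A i)"
    using C by (auto simp: hausdorff_covers_def)
  then have "hausdorff_pre s \<delta> (\<Union>i. A i) \<le> (\<Sum>k. hausdorff_gauge s (?D k))"
    unfolding hausdorff_pre_def by (rule INF_lower)
  also have "\<dots> = (\<Sum>i. \<Sum>j. hausdorff_gauge s (C i j))"
    using suminf_ennreal_2dimen[of "\<lambda>i. \<Sum>j. hausdorff_gauge s (C i j)"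
        "\<lambda>(i, j). hausdorff_gauge s (C i j)"]
    by (simp add: comp_def case_prod_beta)
  also have "\<dots> \<le> (\<Sum>i. hausdorff_pre s \<delta> (A i) + ennreal (e * (1/2)^Suc i))"
    by (intro suminf_le summableI le)
  also have "\<dots> = (\<Sum>i. hausdorff_pre s \<delta> (A i)) + (\<Sum>i. ennreal (e * (1/2)^Suc i))"
    by (rule suminf_add[symmetric]) (auto intro: summableI)
  also have "(\<Sum>i. ennreal (e * (1/2)^Suc i)) = ennreal e"
  proof (rule suminf_ennreal_eq)
    show "(\<lambda>i. e * (1/2)^Suc i) sums e"
      using sums_mult[OF power_half_series, of e] by simp
  qed (use e in auto)
  finally show "hausdorff_pre s \<delta> (\<Union>i. A i) \<le> (\<Sum>i. hausdorff_pre s \<delta> (A i)) + ennreal e" .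
qed

lemma hausdorff_outer_UN: "hausdorff_outer s (\<Union>i::nat. A i) \<le> (\<Sum>i. hausdorff_outer s (A i))"
  unfolding hausdorff_outer_def[of s "\<Union>i. A i"]
proof (rule SUP_least)
  fix \<delta> :: real assume "\<delta> \<in> {0<..}"
  then have "0 < \<delta>" by simp
  then have "hausdorff_pre s \<delta> (\<Union>i. A i) \<le> (\<Sum>i. hausdorff_pre s \<delta> (A i))"
    by (rule hausdorff_pre_UN)
  also have "\<dots> \<le> (\<Sum>i. hausdorff_outer s (A i))"
    by (intro suminf_le summableI hausdorff_pre_le_outer \<open>0 < \<delta>\<close>)
  finally show "hausdorff_pre s \<delta> (\<Union>i. A i) \<le> (\<Sum>i. hausdorff_outer s (A i))" .
qed

lemma outer_measure_space_hausdorff: "outer_measure_space UNIV (hausdorff_outer s)"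
  unfolding outer_measure_space_def positive_def increasing_def countably_subadditive_def
  by (auto intro: hausdorff_outer_mono hausdorff_outer_UN)

lemma hausdorff_outer_Un:
  fixes A B :: "'a::metric_space set"
  shows "hausdorff_outer s (A \<union> B) \<le> hausdorff_outer s A + hausdorff_outer s B"
proof -
  have "subadditive UNIV (hausdorff_outer s :: 'a set \<Rightarrow> ennreal)"
  proof -
    interpret sigma_algebra UNIV "UNIV :: 'a set set"
      using sigma_algebra_Pow[of "UNIV :: 'a set"] by simp
    show ?thesis
      using outer_measure_space_hausdorff[of s, where 'a = 'a]
      by (intro countably_subadditive_subadditive) (simp_all add: outer_measure_space_def)
  qed
  then have "hausdorff_outer s (A \<union> (B - A)) \<le> hausdorff_outer s A + hausdorff_outer s (B - A)"
    unfolding subadditive_def by blast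
  also have "hausdorff_outer s (B - A) \<le> hausdorff_outer s B"
    by (rule hausdorff_outer_mono) auto
  finally show ?thesis by (simp add: add_left_mono)
qed

lemma hausdorff_pre_separated:
  fixes A B :: "'a::metric_space set"
  assumes sep: "\<And>x y. x \<in> A \<Longrightarrow> y \<in> B \<Longrightarrow> \<delta> < dist x y"
  shows "hausdorff_pre s \<delta> A + hausdorff_pre s \<delta> B \<le> hausdorff_pre s \<delta> (A \<union> B)"
  unfolding hausdorff_pre_def[of s \<delta> "A \<union> B"]
proof (rule INF_greatest)
  fix C assume C: "C \<in> hausdorff_covers \<delta> (A \<union> B)"
  define CA where "CA i = (if C i \<inter> A = {} then {} else C i)" for i
  define CB where "CB i = (if C i \<inter> B = {} then {} else C i)" for i
  have cov: "A \<union> B \<subseteq> (\<Union>i. C i)" and bd: "\<And>i. bounded (C i)" and dm: "\<And>i. diameter (C i) \<le> \<delta>"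
    using C unfolding hausdorff_covers_def by blast+
  have nonneg: "0 \<le> \<delta>"
    using order_trans[OF diameter_ge_0[OF bd] dm] .
  have "A \<subseteq> (\<Union>i. CA i)" "B \<subseteq> (\<Union>i. CB i)"
    using cov unfolding CA_def CB_def by (auto, blast+)
  moreover have "bounded (CA i) \<and> diameter (CA i) \<le> \<delta>" "bounded (CB i) \<and> diameter (CB i) \<le> \<delta>" for i
    using bd dm nonneg by (simp_all add: CA_def CB_def)
  ultimately have "CA \<in> hausdorff_covers \<delta> A" "CB \<in> hausdorff_covers \<delta> B"
    unfolding hausdorff_covers_def by blast+
  then have "hausdorff_pre s \<delta> A + hausdorff_pre s \<delta> B
      \<le> (\<Sum>i. hausdorff_gauge s (CA i)) + (\<Sum>i. hausdorff_gauge s (CB i))"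
    unfolding hausdorff_pre_def by (intro add_mono INF_lower)
  also have "\<dots> = (\<Sum>i. hausdorff_gauge s (CA i) + hausdorff_gauge s (CB i))"
    by (rule suminf_add) (auto intro: summableI)
  also have "\<dots> \<le> (\<Sum>i. hausdorff_gauge s (C i))"
  proof (intro suminf_le summableI)
    fix i
    have "C i \<inter> A = {} \<or> C i \<inter> B = {}"
    proof (rule ccontr)
      assume "\<not> ?thesis"
      then obtain x y where xy: "x \<in> C i" "x \<in> A" "y \<in> C i" "y \<in> B" by auto
      then have "dist x y \<le> diameter (C i)"
        by (intro diameter_bounded_bound bd)
      also have "\<dots> \<le> \<delta>" by (rule dm)
      finally show False using sep[of x y] xy by simp
    qed
    then show "hausdorff_gauge s (CA i) + hausdorff_gauge s (CB i) \<le> hausdorff_gauge s (C i)"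
      by (auto simp: CA_def CB_def)
  qed
  finally show "hausdorff_pre s \<delta> A + hausdorff_pre s \<delta> B \<le> (\<Sum>i. hausdorff_gauge s (C i))" .
qed

lemma hausdorff_outer_separated:
  fixes A B :: "'a::metric_space set"
  assumes r: "0 < r" and sep: "\<And>x y. x \<in> A \<Longrightarrow> y \<in> B \<Longrightarrow> r \<le> dist x y"
  shows "hausdorff_outer s A + hausdorff_outer s B \<le> hausdorff_outer s (A \<union> B)"
proof -
  have "hausdorff_pre s d A + hausdorff_pre s e B \<le> hausdorff_outer s (A \<union> B)"
    if "0 < d" "0 < e" for d e
  proof -
    define \<delta> where "\<delta> = min (r / 2) (min d e)"
    have \<delta>: "0 < \<delta>" "\<delta> < r" "\<delta> \<le> d" "\<delta> \<le> e"
      using r that by (auto simp: \<delta>_def)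
    have "hausdorff_pre s d A + hausdorff_pre s e B \<le> hausdorff_pre s \<delta> A + hausdorff_pre s \<delta> B"
      by (intro add_mono hausdorff_pre_antimono \<delta>)
    also have "\<dots> \<le> hausdorff_pre s \<delta> (A \<union> B)"
      using sep \<delta> by (intro hausdorff_pre_separated) (meson less_le_trans)
    also have "\<dots> \<le> hausdorff_outer s (A \<union> B)"
      using \<delta> by (intro hausdorff_pre_le_outer)
    finally show ?thesis .
  qed
  then have "(SUP d\<in>{0<..}. hausdorff_pre s d A + (SUP e\<in>{0<..}. hausdorff_pre s e B))
      \<le> hausdorff_outer s (A \<union> B)"
    by (intro SUP_least) (simp add: ennreal_SUP_add_right SUP_le_iff)
  then show ?thesis
    unfolding hausdorff_outer_def[of s A] hausdorff_outer_def[of s B]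
    by (simp add: ennreal_SUP_add_left)
qed

lemma hausdorff_outer_closed:
  fixes F E :: "'a::metric_space set"
  assumes "closed F"
  shows "hausdorff_outer s (E \<inter> F) + hausdorff_outer s (E - F) = hausdorff_outer s E"
proof (cases "F = {} \<or> hausdorff_outer s E = top")
  case True
  then show ?thesis
  proof
    assume "hausdorff_outer s E = top"
    moreover have "hausdorff_outer s E \<le> hausdorff_outer s (E \<inter> F) + hausdorff_outer s (E - F)"
      using hausdorff_outer_Un[of s "E \<inter> F" "E - F"] by (simp add: Un_Diff_Int Un_commute)
    ultimately show ?thesis by (simp add: top_unique)
  qed simp
next
  case False
  then have "F \<noteq> {}" and fin: "hausdorff_outer s E < top" by (auto simp: top.not_eq_extremum)
  let ?H = "hausdorff_outer s :: 'a set \<Rightarrow> ennreal"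
  have lip: "infdist x F \<le> infdist y F + dist x y" for x y
    by (rule infdist_triangle)
  define G where "G n = {x\<in>E. 1 / real (Suc n) \<le> infdist x F}" for n
  define R where "R k = {x\<in>E. 1 / real (Suc (Suc k)) \<le> infdist x F \<and> infdist x F < 1 / real (Suc k)}" for k
  have sumR: "(\<Sum>i<n. ?H (R (2 * i + p))) \<le> ?H (\<Union>i<n. R (2 * i + p))" for n p
  proof (induction n)
    case (Suc n)
    note IH = Suc.IH
    show ?case
    proof (cases n)
      case 0
      then show ?thesis by (simp add: lessThan_Suc)
    next
      case (Suc m)
      have "(\<Sum>i<Suc n. ?H (R (2 * i + p))) \<le> ?H (\<Union>i<n. R (2 * i + p)) + ?H (R (2 * n + p))"
        using IH by (simp add: add_right_mono)
      also have "\<dots> \<le> ?H ((\<Union>i<n. R (2 * i + p)) \<union> R (2 * n + p))"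
      proof (rule hausdorff_outer_separated)
        show "0 < 1 / real (2 * n + p) - 1 / real (Suc (2 * n + p))"
          using Suc by (simp add: frac_less2 del: of_nat_Suc of_nat_add)
        fix x y assume "x \<in> (\<Union>i<n. R (2 * i + p))" and y: "y \<in> R (2 * n + p)"
        then obtain i where i: "i < n" "x \<in> R (2 * i + p)" by auto
        then have "1 / real (2 * n + p) \<le> 1 / real (Suc (Suc (2 * i + p)))"
          by (intro frac_le) auto
        also have "\<dots> \<le> infdist x F" using i by (simp add: R_def)
        finally have "1 / real (2 * n + p) \<le> infdist x F" .
        moreover have "infdist y F < 1 / real (Suc (2 * n + p))" using y by (simp add: R_def)
        ultimately show "1 / real (2 * n + p) - 1 / real (Suc (2 * n + p)) \<le> dist x y"
          using lip[of x y] by linarith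
      qed
      also have "(\<Union>i<n. R (2 * i + p)) \<union> R (2 * n + p) = (\<Union>i<Suc n. R (2 * i + p))"
        by (auto simp: lessThan_Suc)
      finally show ?thesis .
    qed
  qed simp
  have half: "(\<Sum>i. ?H (R (2 * i + p))) \<le> ?H E" for p
  proof (rule suminf_le_const[OF summableI])
    fix n
    have "?H (\<Union>i<n. R (2 * i + p)) \<le> ?H E"
      by (rule hausdorff_outer_mono) (auto simp: R_def)
    with sumR[of p n] show "(\<Sum>i<n. ?H (R (2 * i + p))) \<le> ?H E" by (rule order_trans)
  qed
  have "(\<Sum>k. ?H (R k)) \<le> ?H E + ?H E"
  proof (rule suminf_le_const[OF summableI])
    fix n
    have "(\<Sum>k<n. ?H (R k)) \<le> (\<Sum>k<2 * n. ?H (R k))"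
      by (rule sum_mono2) auto
    also have "\<dots> = (\<Sum>i<n. ?H (R (2 * i + 0))) + (\<Sum>i<n. ?H (R (2 * i + 1)))"
      by (induction n) (auto simp: algebra_simps)
    also have "\<dots> \<le> ?H E + ?H E"
    proof (rule add_mono)
      show "(\<Sum>i<n. ?H (R (2 * i + 0))) \<le> ?H E"
        by (rule order_trans[OF sum_le_suminf[OF summableI] half[of 0]]) auto
      show "(\<Sum>i<n. ?H (R (2 * i + 1))) \<le> ?H E"
        by (rule order_trans[OF sum_le_suminf[OF summableI] half[of 1]]) auto
    qed
    finally show "(\<Sum>k<n. ?H (R k)) \<le> ?H E + ?H E" .
  qed
  also have "\<dots> < top" using fin by simp
  finally have sum_fin: "(\<Sum>k. ?H (R k)) < top" .
  have tail: "(\<lambda>n. \<Sum>k. ?H (R (k + n))) \<longlonglongrightarrow> 0"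
  proof -
    define f where "f k = enn2real (?H (R k))" for k
    have ne: "?H (R k) < top" for k
      using sum_fin by (rule ennreal_suminf_lessD)
    then have f: "?H (R k) = ennreal (f k)" for k
      by (simp add: f_def)
    have f0: "0 \<le> f k" for k by (simp add: f_def)
    have sf: "summable f"
      using sum_fin f0 by (intro summable_suminf_not_top) (auto simp: f)
    have "(\<lambda>n. suminf f - (\<Sum>i<n. f i)) \<longlonglongrightarrow> suminf f - suminf f"
      using sf by (intro tendsto_diff tendsto_const summable_LIMSEQ)
    then have "(\<lambda>n. \<Sum>k. f (k + n)) \<longlonglongrightarrow> 0"
      using sf by (simp add: suminf_minus_initial_segment)
    then have "(\<lambda>n. ennreal (\<Sum>k. f (k + n))) \<longlonglongrightarrow> ennreal 0"
      by (intro tendsto_ennrealI)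
    moreover have "(\<Sum>k. ?H (R (k + n))) = ennreal (\<Sum>k. f (k + n))" for n
      unfolding f using sf f0 by (intro suminf_ennreal2) (auto simp: summable_iff_shift)
    ultimately show ?thesis by simp
  qed
  have bound: "?H (E \<inter> F) + ?H (E - F) \<le> ?H E + (\<Sum>k. ?H (R (k + n)))" for n
  proof -
    have "E - F \<subseteq> G n \<union> (\<Union>k. R (k + n))"
    proof
      fix x assume x: "x \<in> E - F"
      then have pos: "0 < infdist x F"
        using \<open>closed F\<close> \<open>F \<noteq> {}\<close> by (metis DiffD2 in_closed_iff_infdist_zero infdist_nonneg
            less_eq_real_def)
      show "x \<in> G n \<union> (\<Union>k. R (k + n))"
      proof (cases "1 / real (Suc n) \<le> infdist x F")
        case True
        then show ?thesis using x by (auto simp: G_def)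
      next
        case False
        let ?P = "\<lambda>k. 1 / real (Suc k) \<le> infdist x F"
        obtain K where "1 / real (Suc K) < infdist x F"
          using pos by (rule nat_approx_posE)
        then have K: "?P K" by (rule less_imp_le)
        define k where "k = (LEAST k. ?P k)"
        have k1: "?P k"
          unfolding k_def by (rule LeastI[of ?P, OF K])
        have k2: "\<not> ?P j" if "j < k" for j
          using that unfolding k_def by (rule not_less_Least)
        have "\<not> k \<le> n"
        proof
          assume "k \<le> n"
          then have "1 / real (Suc n) \<le> 1 / real (Suc k)" by (intro frac_le) auto
          with k1 False show False by linarith
        qed
        then have m: "k = Suc ((k - Suc n) + n)" by simp
        define m where "m = k - Suc n"
        have "x \<in> R (m + n)"
          using k1 k2[of "m + n"] x m unfolding R_def m_def[symmetric] by simp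
        then show ?thesis by blast
      qed
    qed
    then have "?H (E - F) \<le> ?H (G n \<union> (\<Union>k. R (k + n)))"
      by (rule hausdorff_outer_mono)
    also have "\<dots> \<le> ?H (G n) + ?H (\<Union>k. R (k + n))"
      by (rule hausdorff_outer_Un)
    also have "\<dots> \<le> ?H (G n) + (\<Sum>k. ?H (R (k + n)))"
      by (intro add_left_mono hausdorff_outer_UN)
    finally have "?H (E \<inter> F) + ?H (E - F) \<le> (?H (E \<inter> F) + ?H (G n)) + (\<Sum>k. ?H (R (k + n)))"
      by (simp add: add_left_mono add.assoc)
    also have "?H (E \<inter> F) + ?H (G n) \<le> ?H (E \<inter> F \<union> G n)"
    proof (rule hausdorff_outer_separated)
      show "0 < 1 / real (Suc n)" by simp
      fix x y assume "x \<in> E \<inter> F" "y \<in> G n"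
      then show "1 / real (Suc n) \<le> dist x y"
        using lip[of y x] by (simp add: G_def dist_commute)
    qed
    also have "\<dots> \<le> ?H E"
      by (rule hausdorff_outer_mono) (auto simp: G_def)
    finally show ?thesis by (simp add: add_right_mono)
  qed
  have "?H (E \<inter> F) + ?H (E - F) \<le> ?H E + 0"
    by (rule LIMSEQ_le_const[OF tendsto_add[OF tendsto_const tail]]) (use bound in auto)
  moreover have "?H E \<le> ?H (E \<inter> F) + ?H (E - F)"
    using hausdorff_outer_Un[of s "E \<inter> F" "E - F"] by (simp add: Un_Diff_Int Un_commute)
  ultimately show ?thesis by (simp add: antisym)
qed

lemma sets_hausdorff_measure [simp, measurable_cong]: "sets (hausdorff_measure s) = sets borel"
  by (metis hausdorff_measure_def sets.sets_measure_of_eq space_borel)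

lemma space_hausdorff_measure [simp]: "space (hausdorff_measure s) = UNIV"
  by (simp add: hausdorff_measure_def space_measure_of_conv)

lemma emeasure_hausdorff_measure:
  fixes A :: "'a::metric_space set"
  assumes "A \<in> sets borel"
  shows "emeasure (hausdorff_measure s) A = hausdorff_outer s A"
proof -
  interpret P: sigma_algebra UNIV "UNIV :: 'a set set"
    using sigma_algebra_Pow[of "UNIV :: 'a set"] by simp
  let ?L = "lambda_system UNIV UNIV (hausdorff_outer s :: 'a set \<Rightarrow> ennreal)"
  have L: "measure_space UNIV ?L (hausdorff_outer s)"
    by (rule P.caratheodory_lemma[OF outer_measure_space_hausdorff])
  then have sL: "sigma_algebra UNIV ?L"
    by (simp add: measure_space_def)
  have "Collect closed \<subseteq> ?L"
  proof
    fix F :: "'a set" assume "F \<in> Collect closed"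
    then show "F \<in> ?L"
      using hausdorff_outer_closed[of F s] by (auto simp: P.lambda_system_eq)
  qed
  then have "sigma_sets UNIV (Collect closed) \<subseteq> ?L"
    by (rule sigma_algebra.sigma_sets_subset[OF sL])
  then have sub: "sets (borel :: 'a measure) \<subseteq> ?L"
    by (simp add: borel_eq_closed)
  have "countably_additive (sets borel) (hausdorff_outer s :: 'a set \<Rightarrow> ennreal)"
    using L sub unfolding measure_space_def countably_additive_def by (meson subset_iff subset_trans)
  moreover have "positive (sets borel) (hausdorff_outer s :: 'a set \<Rightarrow> ennreal)"
    by (simp add: positive_def)
  moreover have "sigma_algebra UNIV (sets (borel :: 'a measure))"
    using sets.sigma_algebra_axioms[of "borel :: 'a measure"] by simp
  ultimately show ?thesis
    unfolding hausdorff_measure_def using assms by (intro emeasure_measure_of_sigma)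
qed


text \<open>\<open>Ck_on k f S\<close> is meant for open \<open>S\<close>, where it says that all partial derivatives of \<open>f\<close> of
  order at most \<open>k\<close> exist and are continuous.\<close>

primrec Ck_on ::
    "nat \<Rightarrow> ('a::euclidean_space \<Rightarrow> 'b::real_normed_vector) \<Rightarrow> 'a set \<Rightarrow> bool" where
  "Ck_on 0 f S \<longleftrightarrow> continuous_on S f"
| "Ck_on (Suc k) f S \<longleftrightarrow> (\<forall>x\<in>S. f differentiable (at x)) \<and>
     (\<forall>v. Ck_on k (\<lambda>x. frechet_derivative f (at x) v) S)"

definition smooth_on :: "('a::euclidean_space \<Rightarrow> 'b::real_normed_vector) \<Rightarrow> 'a set \<Rightarrow> bool" where
  "smooth_on f S \<longleftrightarrow> (\<forall>k. Ck_on k f S)"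

text \<open>Near each boundary point, \<open>\<Omega>\<close> is the strict epigraph of a smooth function over a hyperplane
  \<open>e\<^sup>\<bottom>\<close>; the value of \<open>\<gamma>\<close> is only used on \<open>e\<^sup>\<bottom>\<close>.\<close>

definition smooth_boundary :: "'a::euclidean_space set \<Rightarrow> bool" where
  "smooth_boundary \<Omega> \<longleftrightarrow>
     (\<forall>p\<in>frontier \<Omega>. \<exists>r>0. \<exists>e. \<exists>\<gamma> :: 'a \<Rightarrow> real. norm e = 1 \<and> smooth_on \<gamma> UNIV \<and>
        \<Omega> \<inter> ball p r = {x \<in> ball p r. \<gamma> (x - (x \<bullet> e) *\<^sub>R e) < x \<bullet> e})"

definition grad :: "('a::euclidean_space \<Rightarrow> real) \<Rightarrow> 'a \<Rightarrow> 'a" where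
  "grad f x = (\<Sum>b\<in>Basis. frechet_derivative f (at x) b *\<^sub>R b)"

definition laplacian :: "('a::euclidean_space \<Rightarrow> real) \<Rightarrow> 'a \<Rightarrow> real" where
  "laplacian f x =
     (\<Sum>b\<in>Basis. frechet_derivative (\<lambda>y. frechet_derivative f (at y) b) (at x) b)"

definition test_function :: "'a::euclidean_space set \<Rightarrow> ('a \<Rightarrow> real) \<Rightarrow> bool" where
  "test_function \<Omega> \<phi> \<longleftrightarrow> smooth_on \<phi> UNIV \<and>
     compact (closure {x. \<phi> x \<noteq> 0}) \<and> closure {x. \<phi> x \<noteq> 0} \<subseteq> \<Omega>"

text \<open>Functions on \<open>\<Omega>\<close> are represented by total functions whose values outside \<open>\<Omega>\<close> are
  irrelevant. The weak gradient is a relation, as it is only determined almost everywhere.\<close>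

definition has_weak_gradient :: "'a::euclidean_space set \<Rightarrow> ('a \<Rightarrow> real) \<Rightarrow> ('a \<Rightarrow> 'a) \<Rightarrow> bool" where
  "has_weak_gradient \<Omega> u g \<longleftrightarrow>
     (\<forall>\<phi>. test_function \<Omega> \<phi> \<longrightarrow> (\<forall>b\<in>Basis.
        (LINT x:\<Omega>|lebesgue. u x * (grad \<phi> x \<bullet> b)) = - (LINT x:\<Omega>|lebesgue. (g x \<bullet> b) * \<phi> x)))"

definition W11_gradient :: "'a::euclidean_space set \<Rightarrow> ('a \<Rightarrow> real) \<Rightarrow> ('a \<Rightarrow> 'a) \<Rightarrow> bool" where
  "W11_gradient \<Omega> u g \<longleftrightarrow>
     set_integrable lebesgue \<Omega> u \<and> set_integrable lebesgue \<Omega> g \<and> has_weak_gradient \<Omega> u g"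

definition W011 :: "'a::euclidean_space set \<Rightarrow> ('a \<Rightarrow> real) set" where
  "W011 \<Omega> = {u. \<exists>g. W11_gradient \<Omega> u g \<and>
     (\<exists>\<phi> :: nat \<Rightarrow> 'a \<Rightarrow> real. (\<forall>k. test_function \<Omega> (\<phi> k)) \<and>
        (\<lambda>k. (LINT x:\<Omega>|lebesgue. \<bar>\<phi> k x - u x\<bar>) + (LINT x:\<Omega>|lebesgue. norm (grad (\<phi> k) x - g x)))
          \<longlonglongrightarrow> 0)}"

text \<open>A finite signed Borel measure on \<open>\<Omega>\<close> is represented as the difference of two finite
  nonnegative Borel measures \<open>\<mu>\<close> and \<open>\<nu>\<close> on \<open>\<Omega>\<close>.\<close>

definition laplacian_measure ::
    "'a::euclidean_space set \<Rightarrow> ('a \<Rightarrow> real) \<Rightarrow> 'a measure \<Rightarrow> 'a measure \<Rightarrow> bool" where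
  "laplacian_measure \<Omega> w \<mu> \<nu> \<longleftrightarrow>
     finite_measure \<mu> \<and> sets \<mu> = sets (restrict_space borel \<Omega>) \<and>
     finite_measure \<nu> \<and> sets \<nu> = sets (restrict_space borel \<Omega>) \<and>
     (\<forall>\<phi>. test_function \<Omega> \<phi> \<longrightarrow>
        (LINT x:\<Omega>|lebesgue. w x * laplacian \<phi> x) = (LINT x|\<mu>. \<phi> x) - (LINT x|\<nu>. \<phi> x))"

text \<open>The functions \<open>\<psi>\<close> in \<open>C\<^sup>\<infinity>\<close> of the closure of \<open>\<Omega>\<close> are the restrictions of smooth functions
  on the whole space. The gradient, the signed measure \<open>\<mu> - \<nu>\<close> and \<open>h\<close> are unique (up to null sets)
  when they exist, and \<open>h\<close> exists whenever \<open>w\<close> lies in \<open>W011 \<Omega>\<close>, its Laplacian is a finite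
  measure and \<open>\<Omega>\<close> is a smooth bounded domain. So ``for every \<open>h\<close> with
  \<open>has_normal_derivative \<Omega> w h\<close>'' below speaks about the normal derivative of \<open>w\<close>.\<close>

definition has_normal_derivative ::
    "'a::euclidean_space set \<Rightarrow> ('a \<Rightarrow> real) \<Rightarrow> ('a \<Rightarrow> real) \<Rightarrow> bool" where
  "has_normal_derivative \<Omega> w h \<longleftrightarrow> w \<in> W011 \<Omega> \<and> integrable (surface_measure \<Omega>) h \<and>
     (\<exists>g \<mu> \<nu>. W11_gradient \<Omega> w g \<and> laplacian_measure \<Omega> w \<mu> \<nu> \<and>
        (\<forall>\<psi>. smooth_on \<psi> UNIV \<longrightarrow>
           (LINT x:\<Omega>|lebesgue. g x \<bullet> grad \<psi> x) =
             - ((LINT x|\<mu>. \<psi> x) - (LINT x|\<nu>. \<psi> x)) + (LINT x|surface_measure \<Omega>. \<psi> x * h x)))"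

definition minorants :: "'a::euclidean_space set \<Rightarrow> ('a \<Rightarrow> real) \<Rightarrow> ('a \<Rightarrow> real) set" where
  "minorants \<Omega> u = {w \<in> W011 \<Omega>. (\<exists>\<mu> \<nu>. laplacian_measure \<Omega> w \<mu> \<nu>) \<and>
     (AE x in lebesgue. x \<in> \<Omega> \<longrightarrow> w x \<le> u x)}"

definition lower_bound_of_normal_derivatives ::
    "'a::euclidean_space set \<Rightarrow> ('a \<Rightarrow> real) \<Rightarrow> ('a \<Rightarrow> ereal) \<Rightarrow> bool" where
  "lower_bound_of_normal_derivatives \<Omega> u F \<longleftrightarrow>
     F \<in> borel_measurable (restrict_space borel (frontier \<Omega>)) \<and>
     (\<forall>w\<in>minorants \<Omega> u. \<forall>h. has_normal_derivative \<Omega> w h \<longrightarrow>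
        (AE x in surface_measure \<Omega>. F x \<le> ereal (h x)))"

definition is_ess_normal_derivative ::
    "'a::euclidean_space set \<Rightarrow> ('a \<Rightarrow> real) \<Rightarrow> ('a \<Rightarrow> ereal) \<Rightarrow> bool" where
  "is_ess_normal_derivative \<Omega> u F \<longleftrightarrow>
     lower_bound_of_normal_derivatives \<Omega> u F \<and>
     (\<forall>F'. lower_bound_of_normal_derivatives \<Omega> u F' \<longrightarrow>
        (AE x in surface_measure \<Omega>. F' x \<le> F x))"

definition normal_derivative :: "'a::euclidean_space set \<Rightarrow> ('a \<Rightarrow> real) \<Rightarrow> 'a \<Rightarrow> ereal" where
  "normal_derivative \<Omega> u = (SOME F. is_ess_normal_derivative \<Omega> u F)"

text \<open>The choice of representative is immaterial.\<close>

lemma normal_derivative_AE_eq: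
  assumes "is_ess_normal_derivative \<Omega> u F"
  shows "AE x in surface_measure \<Omega>. normal_derivative \<Omega> u x = F x"
proof -
  have "is_ess_normal_derivative \<Omega> u (normal_derivative \<Omega> u)"
    unfolding normal_derivative_def using assms by (rule someI[where P = "is_ess_normal_derivative \<Omega> u"])
  with assms have "AE x in surface_measure \<Omega>. normal_derivative \<Omega> u x \<le> F x"
    and "AE x in surface_measure \<Omega>. F x \<le> normal_derivative \<Omega> u x"
    unfolding is_ess_normal_derivative_def by blast+
  then show ?thesis by eventually_elim simp
qed

end

theory Submission
  imports Defs
begin

text \<open>
  The zero function is a minorant of \<open>u\<close> because \<open>u \<ge> 0\<close>, and its normal derivative is zero. So every
  lower bound of the normal derivatives of minorants is at most zero, and it remains to show that zero
  is itself a lower bound: every minorant \<open>w\<close> of \<open>u\<close> has a nonnegative normal derivative \<open>h\<close>. This is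
  \<open>normal_derivative_of_minorant_nonneg\<close>, and it carries all the substance.

  The sign of \<open>h\<close> is read off locally. Near a boundary point \<open>\<Omega>\<close> lies above a graph, and the height
  \<open>\<rho>\<close> above this graph is smooth, vanishes on the boundary and satisfies \<open>d \<le> \<rho>\<close> inside, where \<open>d\<close> is the
  distance to the boundary. For a cutoff \<open>\<zeta>\<close> supported near the point put
  \<open>\<psi> = \<zeta>\<^sup>2 \<Phi>(\<rho> / \<epsilon>)\<close>, where \<open>\<Phi>\<close> is smooth and convex on \<open>[0, \<infinity>)\<close>, positive at \<open>0\<close> and zero on
  \<open>[1, \<infinity>)\<close>. The definition of the normal derivative and Green's formula for \<open>w\<close> (lemma \<open>W011_green\<close>;
  there is no boundary term as \<open>w\<close> vanishes on the boundary) give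
  \<open>\<Phi>(0) \<integral> \<zeta>\<^sup>2 h d\<sigma> = - \<integral> w \<Delta>\<psi> + \<integral> \<psi> d(\<Delta>w)\<close>, and the last integral tends to zero with \<open>\<epsilon>\<close>.

  For the other integral the decisive fact is a one-sided bound (lemma \<open>barrier_laplacian_bounds\<close>):
  \<open>- C \<le> \<Delta>\<psi> \<le> C / \<epsilon>\<^sup>2\<close> on the layer \<open>0 < \<rho> < \<epsilon>\<close>. The leading term \<open>\<zeta>\<^sup>2 \<Phi>'' |\<nabla>\<rho>|\<^sup>2 / \<epsilon>\<^sup>2\<close> is nonnegative by
  convexity. The terms of order \<open>1 / \<epsilon>\<close> have no sign, but up to a constant factor they are bounded
  by \<open>\<bar>\<zeta>\<bar> \<bar>\<Phi>'\<bar> / \<epsilon>\<close>: a full factor \<open>\<zeta>\<close> survives because the cutoff is squared. For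
  \<open>\<Phi>(t) = exp (- 4 / (1 - t))\<close> one has \<open>\<Phi>'\<^sup>2 \<le> 2 \<Phi> \<Phi>''\<close> on \<open>[0, 1)\<close>, so completing the square absorbs them
  into the leading term up to a constant. Where \<open>w \<ge> 0\<close> one has \<open>w \<Delta>\<psi> \<le> C u / \<epsilon>\<^sup>2 \<le> C u / d\<^sup>2\<close>; where \<open>w < 0\<close>
  one has \<open>w \<Delta>\<psi> \<le> C \<bar>w\<bar>\<close>. Both bounds are integrable and live on a layer that shrinks to the boundary,
  so \<open>\<integral> \<zeta>\<^sup>2 h d\<sigma> \<ge> 0\<close> (lemma \<open>boundary_pairing_nonneg\<close>).

  Finally, if \<open>\<integral> \<zeta>\<^sup>2 h d\<sigma> \<ge> 0\<close> for all cutoffs then \<open>h \<ge> 0\<close> almost everywhere near the point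
  (lemma \<open>AE_nonneg_if_test_integrals_nonneg\<close>), and compactness of the boundary finishes the proof.
\<close>

section \<open>Calculus of smooth functions\<close>

lemma frechet_derivative_eqI:
  assumes "(f has_derivative f') (at x)"
  shows "frechet_derivative f (at x) v = f' v"
  using frechet_derivative_at[OF assms] by simp

text \<open>The definition of \<^const>\<open>Ck_on\<close> refers to the derivative chosen by
  \<^const>\<open>frechet_derivative\<close>; this form accepts any explicit derivative and is what the closure
  properties below are proved with.\<close>

lemma Ck_on_SucI:
  assumes "\<And>x. (f has_derivative f' x) (at x)" and "\<And>v. Ck_on k (\<lambda>x. f' x v) UNIV"
  shows "Ck_on (Suc k) f UNIV"
  using assms by (auto simp: frechet_derivative_eqI[OF assms(1)] differentiable_def)

lemma Ck_on_has_derivative: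
  assumes "Ck_on (Suc k) f UNIV"
  shows "(f has_derivative frechet_derivative f (at x)) (at x)"
  using assms frechet_derivative_works by auto

lemma Ck_on_derivative:
  assumes "Ck_on (Suc k) f UNIV"
  shows "Ck_on k (\<lambda>x. frechet_derivative f (at x) v) UNIV"
  using assms by auto

lemma Ck_on_SucD: "Ck_on (Suc k) f UNIV \<Longrightarrow> Ck_on k f UNIV"
proof (induction k arbitrary: f)
  case 0
  then show ?case
    by (auto intro!: differentiable_imp_continuous_on simp: differentiable_on_def)
next
  case (Suc k)
  from Suc.prems have "\<And>x. f differentiable (at x)"
    and "\<And>v. Ck_on (Suc k) (\<lambda>x. frechet_derivative f (at x) v) UNIV" by auto
  then show ?case using Suc.IH by auto
qed

lemma Ck_on_const: "Ck_on k (\<lambda>_. c) UNIV"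
proof (induction k arbitrary: c)
  case (Suc k)
  show ?case by (rule Ck_on_SucI[where f' = "\<lambda>_ _. 0"]) (auto intro: Suc.IH)
qed simp

lemma Ck_on_bounded_linear:
  assumes "bounded_linear L"
  shows "Ck_on k L UNIV"
proof (cases k)
  case 0
  then show ?thesis using assms by (simp add: linear_continuous_on)
next
  case (Suc m)
  then show ?thesis using Ck_on_SucI[of L "\<lambda>_. L" m] assms Ck_on_const
    by (metis bounded_linear_imp_has_derivative)
qed

lemma Ck_on_add:
  assumes "Ck_on k f UNIV" "Ck_on k g UNIV"
  shows "Ck_on k (\<lambda>x. f x + g x) UNIV"
  using assms
proof (induction k arbitrary: f g)
  case 0
  then show ?case by (auto intro: continuous_on_add)
next
  case (Suc k)
  note d = Ck_on_has_derivative[OF Suc.prems(1)] Ck_on_has_derivative[OF Suc.prems(2)]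
  show ?case
    by (rule Ck_on_SucI[OF has_derivative_add[OF d]])
      (intro Suc.IH Ck_on_derivative Suc.prems)
qed

lemma Ck_on_mult:
  fixes f g :: "'a::euclidean_space \<Rightarrow> real"
  assumes "Ck_on k f UNIV" "Ck_on k g UNIV"
  shows "Ck_on k (\<lambda>x. f x * g x) UNIV"
  using assms
proof (induction k arbitrary: f g)
  case 0
  then show ?case by (auto intro: continuous_on_mult)
next
  case (Suc k)
  note d = Ck_on_has_derivative[OF Suc.prems(1)] Ck_on_has_derivative[OF Suc.prems(2)]
  show ?case
    by (rule Ck_on_SucI[OF has_derivative_mult[OF d]])
      (intro Ck_on_add Suc.IH Ck_on_derivative Ck_on_SucD[OF Suc.prems(1)]
        Ck_on_SucD[OF Suc.prems(2)] Suc.prems)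
qed

lemma Ck_on_compose_linear:
  fixes L :: "'a::euclidean_space \<Rightarrow> 'b::euclidean_space"
  assumes "Ck_on k f UNIV" "bounded_linear L"
  shows "Ck_on k (\<lambda>x. f (L x)) UNIV"
  using assms(1)
proof (induction k arbitrary: f)
  case 0
  then show ?case
    using continuous_on_compose2[of UNIV f UNIV L] linear_continuous_on[OF assms(2)] by auto
next
  case (Suc k)
  have "((\<lambda>x. f (L x)) has_derivative (\<lambda>v. frechet_derivative f (at (L x)) (L v))) (at x)" for x
    using has_derivative_compose[OF bounded_linear_imp_has_derivative[OF assms(2)]
        Ck_on_has_derivative[OF Suc.prems]] .
  then show ?case
    by (rule Ck_on_SucI) (intro Suc.IH Ck_on_derivative Suc.prems)
qed

lemma has_derivative_compose_real:
  fixes f :: "real \<Rightarrow> real"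
  assumes "f differentiable (at (g x))" "(g has_derivative g') (at x)"
  shows "((\<lambda>x. f (g x)) has_derivative (\<lambda>v. deriv f (g x) * g' v)) (at x)"
proof -
  have "(f has_field_derivative deriv f (g x)) (at (g x))"
    using assms(1) by (simp add: DERIV_deriv_iff_real_differentiable)
  then show ?thesis
    using has_derivative_compose[OF assms(2)] by (simp add: has_field_derivative_def)
qed

lemma frechet_derivative_real:
  fixes f :: "real \<Rightarrow> real"
  assumes "f differentiable (at t)"
  shows "frechet_derivative f (at t) v = deriv f t * v"
  by (rule frechet_derivative_eqI)
    (metis DERIV_deriv_iff_real_differentiable assms has_field_derivative_def)

lemma Ck_on_deriv:
  fixes f :: "real \<Rightarrow> real"
  assumes "Ck_on (Suc k) f UNIV"
  shows "Ck_on k (deriv f) UNIV"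
proof -
  have "deriv f = (\<lambda>x. frechet_derivative f (at x) 1)"
    using assms by (auto simp: frechet_derivative_real)
  then show ?thesis using Ck_on_derivative[OF assms] by simp
qed

lemma Ck_on_compose_real:
  fixes f :: "real \<Rightarrow> real"
  assumes "Ck_on k f UNIV" "Ck_on k g UNIV"
  shows "Ck_on k (\<lambda>x. f (g x)) UNIV"
  using assms
proof (induction k arbitrary: f)
  case 0
  then show ?case by (auto intro: continuous_on_compose2)
next
  case (Suc k)
  have "f differentiable (at t)" for t using Suc.prems by auto
  from has_derivative_compose_real[OF this Ck_on_has_derivative[OF Suc.prems(2)]]
  show ?case
    by (rule Ck_on_SucI)
      (rule Ck_on_mult[OF Suc.IH[OF Ck_on_deriv[OF Suc.prems(1)] Ck_on_SucD[OF Suc.prems(2)]]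
          Ck_on_derivative[OF Suc.prems(2)]])
qed

lemma smooth_on_const [simp]: "smooth_on (\<lambda>_. c) UNIV"
  by (simp add: smooth_on_def Ck_on_const)

lemma smooth_on_bounded_linear: "bounded_linear L \<Longrightarrow> smooth_on L UNIV"
  by (simp add: smooth_on_def Ck_on_bounded_linear)

lemma smooth_on_inner: "smooth_on (\<lambda>x. x \<bullet> v) UNIV"
  by (intro smooth_on_bounded_linear bounded_linear_inner_left)

lemma smooth_on_add:
  "smooth_on f UNIV \<Longrightarrow> smooth_on g UNIV \<Longrightarrow> smooth_on (\<lambda>x. f x + g x) UNIV"
  by (simp add: smooth_on_def Ck_on_add)

lemma smooth_on_mult:
  fixes f g :: "'a::euclidean_space \<Rightarrow> real"
  shows "smooth_on f UNIV \<Longrightarrow> smooth_on g UNIV \<Longrightarrow> smooth_on (\<lambda>x. f x * g x) UNIV"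
  by (simp add: smooth_on_def Ck_on_mult)

lemma smooth_on_diff:
  fixes f g :: "'a::euclidean_space \<Rightarrow> real"
  assumes "smooth_on f UNIV" "smooth_on g UNIV"
  shows "smooth_on (\<lambda>x. f x - g x) UNIV"
  using smooth_on_add[OF assms(1) smooth_on_mult[OF smooth_on_const[of "-1"] assms(2)]] by simp

lemma smooth_on_sum:
  assumes "finite I" "\<And>i. i \<in> I \<Longrightarrow> smooth_on (f i) UNIV"
  shows "smooth_on (\<lambda>x. \<Sum>i\<in>I. f i x) UNIV"
  using assms by (induction I rule: finite_induct) (auto intro: smooth_on_add)

lemma smooth_on_compose_linear:
  fixes L :: "'a::euclidean_space \<Rightarrow> 'b::euclidean_space"
  shows "smooth_on f UNIV \<Longrightarrow> bounded_linear L \<Longrightarrow> smooth_on (\<lambda>x. f (L x)) UNIV"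
  by (simp add: smooth_on_def Ck_on_compose_linear)

lemma smooth_on_compose_real:
  fixes f :: "real \<Rightarrow> real"
  shows "smooth_on f UNIV \<Longrightarrow> smooth_on g UNIV \<Longrightarrow> smooth_on (\<lambda>x. f (g x)) UNIV"
  by (simp add: smooth_on_def Ck_on_compose_real)

lemma smooth_on_has_derivative:
  "smooth_on f UNIV \<Longrightarrow> (f has_derivative frechet_derivative f (at x)) (at x)"
  unfolding smooth_on_def using Ck_on_has_derivative by blast

lemma smooth_on_derivative:
  "smooth_on f UNIV \<Longrightarrow> smooth_on (\<lambda>x. frechet_derivative f (at x) v) UNIV"
  unfolding smooth_on_def using Ck_on_derivative by blast

lemma smooth_on_deriv:
  fixes f :: "real \<Rightarrow> real"
  shows "smooth_on f UNIV \<Longrightarrow> smooth_on (deriv f) UNIV"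
  unfolding smooth_on_def using Ck_on_deriv by blast

lemma smooth_on_imp_continuous_on: "smooth_on f UNIV \<Longrightarrow> continuous_on S f"
  unfolding smooth_on_def by (metis Ck_on.simps(1) continuous_on_subset subset_UNIV)

lemma smooth_on_laplacian: "smooth_on f UNIV \<Longrightarrow> smooth_on (laplacian f) UNIV"
  unfolding laplacian_def [abs_def] by (intro smooth_on_sum smooth_on_derivative) auto

lemma grad_inner_Basis: "b \<in> Basis \<Longrightarrow> grad f x \<bullet> b = frechet_derivative f (at x) b"
  unfolding grad_def by (simp add: inner_sum_left inner_Basis if_distrib cong: if_cong)

lemma grad_inner:
  "grad f x \<bullet> z = (\<Sum>b\<in>Basis. frechet_derivative f (at x) b * (z \<bullet> b))"
  unfolding grad_def by (simp add: inner_sum_left inner_commute[of z])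

lemma grad_inner_grad: "grad f x \<bullet> grad g x
    = (\<Sum>b\<in>Basis. frechet_derivative f (at x) b * frechet_derivative g (at x) b)"
  unfolding grad_inner[of f] by (simp add: grad_inner_Basis)

lemma frechet_derivative_mult:
  fixes f g :: "'a::euclidean_space \<Rightarrow> real"
  assumes "smooth_on f UNIV" "smooth_on g UNIV"
  shows "frechet_derivative (\<lambda>x. f x * g x) (at x) v
    = f x * frechet_derivative g (at x) v + frechet_derivative f (at x) v * g x"
  by (rule frechet_derivative_eqI[OF has_derivative_mult])
    (intro smooth_on_has_derivative assms)+

lemma frechet_derivative_add:
  assumes "smooth_on f UNIV" "smooth_on g UNIV"
  shows "frechet_derivative (\<lambda>x. f x + g x) (at x) v
    = frechet_derivative f (at x) v + frechet_derivative g (at x) v"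
  by (rule frechet_derivative_eqI[OF has_derivative_add])
    (intro smooth_on_has_derivative assms)+

lemma frechet_derivative_compose_real:
  fixes f :: "real \<Rightarrow> real"
  assumes "smooth_on f UNIV" "smooth_on g UNIV"
  shows "frechet_derivative (\<lambda>x. f (g x)) (at x) v
    = deriv f (g x) * frechet_derivative g (at x) v"
  using assms by (intro frechet_derivative_eqI has_derivative_compose_real smooth_on_has_derivative)
    (auto dest: smooth_on_has_derivative simp: differentiable_def)

lemma laplacian_mult:
  fixes f g :: "'a::euclidean_space \<Rightarrow> real"
  assumes f: "smooth_on f UNIV" and g: "smooth_on g UNIV"
  shows "laplacian (\<lambda>x. f x * g x) x
    = f x * laplacian g x + 2 * (grad f x \<bullet> grad g x) + laplacian f x * g x"
proof -
  note s = f g smooth_on_derivative[OF f] smooth_on_derivative[OF g]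
  have "laplacian (\<lambda>x. f x * g x) x = (\<Sum>b\<in>Basis.
      frechet_derivative (\<lambda>y. f y * frechet_derivative g (at y) b + frechet_derivative f (at y) b * g y) (at x) b)"
    unfolding laplacian_def by (simp add: frechet_derivative_mult f g)
  also have "\<dots> = (\<Sum>b\<in>Basis.
      f x * frechet_derivative (\<lambda>y. frechet_derivative g (at y) b) (at x) b
      + 2 * (frechet_derivative f (at x) b * frechet_derivative g (at x) b)
      + frechet_derivative (\<lambda>y. frechet_derivative f (at y) b) (at x) b * g x)"
    by (intro sum.cong refl)
      (simp add: frechet_derivative_add frechet_derivative_mult smooth_on_mult s)
  finally show ?thesis
    unfolding laplacian_def
    by (simp add: sum.distrib sum_distrib_left sum_distrib_right grad_inner_grad)
qed

lemma laplacian_compose_real: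
  fixes f :: "real \<Rightarrow> real"
  assumes f: "smooth_on f UNIV" and g: "smooth_on g UNIV"
  shows "laplacian (\<lambda>x. f (g x)) x
    = deriv (deriv f) (g x) * (norm (grad g x))\<^sup>2 + deriv f (g x) * laplacian g x"
proof -
  note s = f g smooth_on_derivative[OF g] smooth_on_deriv[OF f]
    smooth_on_compose_real[OF smooth_on_deriv[OF f] g]
  have "laplacian (\<lambda>x. f (g x)) x = (\<Sum>b\<in>Basis.
      frechet_derivative (\<lambda>y. deriv f (g y) * frechet_derivative g (at y) b) (at x) b)"
    unfolding laplacian_def by (simp add: frechet_derivative_compose_real f g)
  also have "\<dots> = (\<Sum>b\<in>Basis.
      deriv f (g x) * frechet_derivative (\<lambda>y. frechet_derivative g (at y) b) (at x) b
      + deriv (deriv f) (g x) * (frechet_derivative g (at x) b * frechet_derivative g (at x) b))"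
    by (intro sum.cong refl) (simp add: frechet_derivative_mult frechet_derivative_compose_real s)
  finally show ?thesis
    unfolding laplacian_def power2_norm_eq_inner
    by (simp add: sum.distrib sum_distrib_left grad_inner_grad)
qed

lemma grad_compose_real:
  fixes f :: "real \<Rightarrow> real"
  assumes "smooth_on f UNIV" "smooth_on g UNIV"
  shows "grad (\<lambda>x. f (g x)) x = deriv f (g x) *\<^sub>R grad g x"
  unfolding grad_def by (simp add: frechet_derivative_compose_real assms scaleR_sum_right)

lemma grad_mult:
  fixes f g :: "'a::euclidean_space \<Rightarrow> real"
  assumes "smooth_on f UNIV" "smooth_on g UNIV"
  shows "grad (\<lambda>x. f x * g x) x = f x *\<^sub>R grad g x + g x *\<^sub>R grad f x"
  unfolding grad_def
  by (simp add: frechet_derivative_mult assms scaleR_sum_right sum.distrib scaleR_add_left mult.commute)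

lemma continuous_on_grad: "smooth_on f UNIV \<Longrightarrow> continuous_on S (grad f)"
  unfolding grad_def [abs_def]
  by (intro continuous_intros smooth_on_imp_continuous_on smooth_on_derivative)

section \<open>The flat exponential\<close>

text \<open>All derivatives of \<open>exp (- 1 / t)\<close> on the positive axis are polynomials in \<open>1 / t\<close> times the
  function itself. Carrying the polynomial as a parameter makes this family closed under
  differentiation, so that smoothness is a plain induction.\<close>

definition flat_exp :: "real poly \<Rightarrow> real \<Rightarrow> real" where
  "flat_exp P t = (if 0 < t then poly P (1 / t) * exp (- 1 / t) else 0)"

text \<open>Exponential decay beats every polynomial; with \<open>y = 1 / t\<close> this is what makes the glueing with
  the zero function at \<open>t = 0\<close> differentiable.\<close>

lemma poly_mult_exp_tendsto_0: "((\<lambda>y. poly P y * exp (- y)) \<longlongrightarrow> (0::real)) at_top"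
proof -
  have "((\<lambda>y. \<Sum>i\<le>degree P. coeff P i * (y ^ i / exp y)) \<longlongrightarrow> (\<Sum>i\<le>degree P. coeff P i * 0)) at_top"
    by (intro tendsto_intros tendsto_power_div_exp_0)
  then show ?thesis
    by (simp add: poly_altdef sum_distrib_right exp_minus divide_inverse mult.assoc)
qed

text \<open>The factor \<open>[:0, 0, 1:]\<close> is \<open>y\<^sup>2\<close> at \<open>y = 1 / t\<close>, coming from the derivative
  \<open>- 1 / t\<^sup>2\<close> of the argument.\<close>

lemma flat_exp_has_derivative:
  "(flat_exp P has_field_derivative flat_exp ([:0, 0, 1:] * (P - pderiv P)) t) (at t)"
proof -
  let ?Q = "[:0, 0, 1:] * (P - pderiv P)"
  consider "t < 0" | "t = 0" | "0 < t" by linarith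
  then show ?thesis
  proof cases
    case 1
    have "((\<lambda>_. 0) has_field_derivative flat_exp ?Q t) (at t)"
      using 1 by (simp add: flat_exp_def)
    then show ?thesis
      by (rule has_field_derivative_transform_within_open[where S = "{..<0}"])
        (use 1 in \<open>auto simp: flat_exp_def\<close>)
  next
    case 2
    have "((\<lambda>y. flat_exp P y / y) \<longlongrightarrow> 0) (at_right 0)"
    proof -
      have "((\<lambda>y. poly ([:0, 1:] * P) y * exp (- y)) \<longlongrightarrow> 0) at_top"
        by (rule poly_mult_exp_tendsto_0)
      then have "((\<lambda>y. poly ([:0, 1:] * P) (inverse y) * exp (- inverse y)) \<longlongrightarrow> 0) (at_right 0)"
        by (rule filterlim_compose) (rule filterlim_inverse_at_top_right)
      then show ?thesis
        by (rule Lim_transform_eventually)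
          (auto simp: flat_exp_def eventually_at_filter divide_inverse)
    qed
    moreover have "((\<lambda>y. flat_exp P y / y) \<longlongrightarrow> 0) (at_left 0)"
      by (rule Lim_transform_eventually[OF tendsto_const])
        (auto simp: flat_exp_def eventually_at_filter)
    ultimately have "((\<lambda>y. flat_exp P y / y) \<longlongrightarrow> 0) (at 0)"
      by (simp add: filterlim_split_at)
    then show ?thesis
      using 2 by (simp add: has_field_derivative_iff flat_exp_def)
  next
    case 3
    have "((\<lambda>t. poly P (1 / t) * exp (- 1 / t)) has_field_derivative flat_exp ?Q t) (at t)"
      using 3 by (auto intro!: derivative_eq_intros DERIV_chain2[OF poly_DERIV]
          simp: flat_exp_def field_simps power2_eq_square)
    then show ?thesis
      by (rule has_field_derivative_transform_within_open[where S = "{0<..}"])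
        (use 3 in \<open>auto simp: flat_exp_def\<close>)
  qed
qed

lemma deriv_flat_exp: "deriv (flat_exp P) = flat_exp ([:0, 0, 1:] * (P - pderiv P))"
  by (rule ext) (rule DERIV_imp_deriv[OF flat_exp_has_derivative])

lemma smooth_on_flat_exp: "smooth_on (flat_exp P) UNIV"
proof -
  have "Ck_on k (flat_exp P) UNIV" for k
  proof (induction k arbitrary: P)
    case 0
    show ?case
      by (metis Ck_on.simps(1) DERIV_continuous_on flat_exp_has_derivative
          has_field_derivative_at_within)
  next
    case (Suc k)
    have "(flat_exp P has_derivative (\<lambda>v. flat_exp ([:0, 0, 1:] * (P - pderiv P)) x * v)) (at x)" for x
      using flat_exp_has_derivative by (simp add: has_field_derivative_def)
    then show ?case
      by (rule Ck_on_SucI) (intro Ck_on_mult Suc.IH Ck_on_const)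
  qed
  then show ?thesis by (simp add: smooth_on_def)
qed

section \<open>Test functions\<close>

lemma test_functionI:
  assumes "smooth_on \<phi> UNIV" "compact K" "K \<subseteq> \<Omega>" "\<And>x. x \<notin> K \<Longrightarrow> \<phi> x = 0"
  shows "test_function \<Omega> \<phi>"
proof -
  have "closure {x. \<phi> x \<noteq> 0} \<subseteq> K"
    using assms by (intro closure_minimal) (auto intro: compact_imp_closed)
  then show ?thesis
    using assms unfolding test_function_def
    by (meson bounded_subset closed_closure compact_eq_bounded_closed subset_trans)
qed

lemma test_functionE:
  assumes "test_function \<Omega> \<phi>"
  obtains K where "smooth_on \<phi> UNIV" "compact K" "K \<subseteq> \<Omega>" "\<And>x. x \<notin> K \<Longrightarrow> \<phi> x = 0"
    "\<And>x v. x \<notin> K \<Longrightarrow> frechet_derivative \<phi> (at x) v = 0"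
proof (rule that[of "closure {x. \<phi> x \<noteq> 0}"])
  fix x v
  assume x: "x \<notin> closure {x. \<phi> x \<noteq> 0}"
  have "((\<lambda>_. 0) has_derivative (\<lambda>_. 0)) (at x)" by simp
  then have "(\<phi> has_derivative (\<lambda>_. 0)) (at x)"
    by (rule has_derivative_transform_within_open[of _ _ _ _ "- closure {x. \<phi> x \<noteq> 0}"])
      (use x closure_subset[of "{x. \<phi> x \<noteq> 0}"] in auto)
  then show "frechet_derivative \<phi> (at x) v = 0"
    by (rule frechet_derivative_eqI)
next
  show "\<phi> x = 0" if "x \<notin> closure {x. \<phi> x \<noteq> 0}" for x
    using that closure_subset[of "{x. \<phi> x \<noteq> 0}"] by blast
qed (use assms in \<open>auto simp: test_function_def\<close>)

lemma test_function_smooth: "test_function \<Omega> \<phi> \<Longrightarrow> smooth_on \<phi> UNIV"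
  by (simp add: test_function_def)

lemma test_function_mono: "test_function U \<phi> \<Longrightarrow> U \<subseteq> V \<Longrightarrow> test_function V \<phi>"
  by (auto simp: test_function_def)

lemma test_function_0 [simp]: "test_function \<Omega> (\<lambda>_. 0)"
  by (rule test_functionI[of _ "{}"]) auto

lemma test_function_mult:
  assumes "test_function \<Omega> \<phi>" "smooth_on f UNIV"
  shows "test_function \<Omega> (\<lambda>x. \<phi> x * f x)"
  by (rule test_functionE[OF assms(1)], rule test_functionI)
    (use assms in \<open>auto intro: smooth_on_mult\<close>)

lemma test_function_add:
  assumes "test_function \<Omega> \<phi>" "test_function \<Omega> \<psi>"
  shows "test_function \<Omega> (\<lambda>x. \<phi> x + \<psi> x)"
proof -
  obtain K where K: "smooth_on \<phi> UNIV" "compact K" "K \<subseteq> \<Omega>" "\<And>x. x \<notin> K \<Longrightarrow> \<phi> x = 0"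
    using test_functionE[OF assms(1)] by metis
  obtain L where L: "smooth_on \<psi> UNIV" "compact L" "L \<subseteq> \<Omega>" "\<And>x. x \<notin> L \<Longrightarrow> \<psi> x = 0"
    using test_functionE[OF assms(2)] by metis
  show ?thesis
    by (rule test_functionI[of _ "K \<union> L"]) (use K L in \<open>auto intro: smooth_on_add\<close>)
qed

lemma test_function_sum:
  assumes "finite I" "\<And>i. i \<in> I \<Longrightarrow> test_function \<Omega> (\<phi> i)"
  shows "test_function \<Omega> (\<lambda>x. \<Sum>i\<in>I. \<phi> i x)"
  using assms by (induction I rule: finite_induct) (auto intro: test_function_add)

lemma test_function_compose_real:
  assumes "test_function \<Omega> \<phi>" "smooth_on f UNIV" "f 0 = 0"
  shows "test_function \<Omega> (\<lambda>x. f (\<phi> x))"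
  by (rule test_functionE[OF assms(1)], rule test_functionI)
    (use assms in \<open>auto intro: smooth_on_compose_real\<close>)

lemma test_function_derivative:
  assumes "test_function \<Omega> \<phi>"
  shows "test_function \<Omega> (\<lambda>x. frechet_derivative \<phi> (at x) v)"
  by (rule test_functionE[OF assms], rule test_functionI) (auto intro: smooth_on_derivative)

lemma test_function_eq_0: "test_function \<Omega> \<phi> \<Longrightarrow> x \<notin> \<Omega> \<Longrightarrow> \<phi> x = 0"
  by (erule test_functionE) auto

lemma test_function_bounded:
  assumes "test_function \<Omega> \<phi>"
  obtains B where "\<And>x. \<bar>\<phi> x\<bar> \<le> B" "0 \<le> B"
proof -
  obtain K where K: "compact K" "\<And>x. x \<notin> K \<Longrightarrow> \<phi> x = 0" and s: "smooth_on \<phi> UNIV"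
    using test_functionE[OF assms] by metis
  have "compact (\<phi> ` K)"
    using K s by (intro compact_continuous_image smooth_on_imp_continuous_on)
  then obtain B where B: "\<And>x. x \<in> K \<Longrightarrow> \<bar>\<phi> x\<bar> \<le> B"
    by (metis bounded_iff compact_imp_bounded imageI real_norm_def)
  have "\<bar>\<phi> x\<bar> \<le> max B 0" for x
    using B[of x] K(2)[of x] by (cases "x \<in> K") auto
  then show ?thesis
    using that[of "max B 0"] by simp
qed

lemma test_function_integrable:
  assumes "test_function \<Omega> \<phi>"
  shows "integrable lborel \<phi>"
proof -
  obtain K where K: "compact K" "\<And>x. x \<notin> K \<Longrightarrow> \<phi> x = 0" and s: "smooth_on \<phi> UNIV"
    using test_functionE[OF assms] by metis
  have "integrable lborel (\<lambda>x. indicator K x *\<^sub>R \<phi> x)"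
    by (intro borel_integrable_compact K smooth_on_imp_continuous_on s)
  also have "(\<lambda>x. indicator K x *\<^sub>R \<phi> x) = \<phi>"
    using K by (auto simp: indicator_def fun_eq_iff)
  finally show ?thesis .
qed

lemma flat_exp_1: "flat_exp 1 t = (if 0 < t then exp (- 1 / t) else 0)"
  by (simp add: flat_exp_def)

lemma flat_exp_1_bounds: "0 \<le> flat_exp 1 t" "flat_exp 1 t \<le> 1"
  by (auto simp: flat_exp_1)

lemma bump_at:
  assumes "open U" "a \<in> U"
  obtains \<beta> where "test_function U \<beta>" "\<And>x. 0 \<le> \<beta> x" "0 < \<beta> a"
proof -
  obtain r where r: "0 < r" "cball a r \<subseteq> U"
    using assms open_contains_cball by blast
  define \<beta> where "\<beta> x = flat_exp 1 (r\<^sup>2 - (x - a) \<bullet> (x - a))" for x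
  have "smooth_on (\<lambda>x. r\<^sup>2 - (x - a) \<bullet> (x - a)) UNIV"
  proof -
    have "smooth_on (\<lambda>x. \<Sum>b\<in>Basis. (x \<bullet> b - a \<bullet> b) * (x \<bullet> b - a \<bullet> b)) UNIV"
      by (intro smooth_on_sum smooth_on_mult smooth_on_diff smooth_on_inner smooth_on_const) auto
    moreover have "(\<lambda>x. (x - a) \<bullet> (x - a)) = (\<lambda>x. \<Sum>b\<in>Basis. (x \<bullet> b - a \<bullet> b) * (x \<bullet> b - a \<bullet> b))"
      by (rule ext, subst euclidean_inner) (simp add: inner_diff_left)
    ultimately have "smooth_on (\<lambda>x. (x - a) \<bullet> (x - a)) UNIV" by simp
    then show ?thesis by (intro smooth_on_diff smooth_on_const)
  qed
  then have "smooth_on \<beta> UNIV"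
    unfolding \<beta>_def [abs_def] by (rule smooth_on_compose_real[OF smooth_on_flat_exp])
  moreover have "\<beta> x = 0" if "x \<notin> cball a r" for x
  proof -
    have "r\<^sup>2 \<le> (norm (x - a))\<^sup>2"
      using that r by (intro power_mono) (auto simp: dist_norm norm_minus_commute)
    then show ?thesis by (simp add: \<beta>_def flat_exp_1 power2_norm_eq_inner)
  qed
  ultimately have "test_function U \<beta>"
    using r by (intro test_functionI[of \<beta> "cball a r"]) auto
  then show ?thesis
    by (rule that) (use r in \<open>auto simp: \<beta>_def flat_exp_1\<close>)
qed

text \<open>By Lindelof's theorem countably many bumps suffice to be positive somewhere at every point of
  \<open>U\<close>. If \<open>S n\<close> is the sum of the first \<open>n\<close> of them then \<open>n * S n\<close> tends to infinity on \<open>U\<close>, and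
  \<open>exp (- 1 / t)\<close> maps this to a bounded sequence with limit \<open>1\<close>, without destroying smoothness at
  the zeros of \<open>S n\<close>. Multiplying by it localises a smooth function
  to \<open>U\<close>, and the sequence and its square both approximate the indicator of \<open>U\<close>.\<close>

lemma test_function_exhaustion:
  fixes U :: "'a::euclidean_space set"
  assumes "open U"
  obtains \<theta> :: "nat \<Rightarrow> 'a \<Rightarrow> real" where "\<And>n. test_function U (\<theta> n)"
    "\<And>n x. 0 \<le> \<theta> n x" "\<And>n x. \<theta> n x \<le> 1" "\<And>x. x \<in> U \<Longrightarrow> (\<lambda>n. \<theta> n x) \<longlonglongrightarrow> 1"
proof -
  have "\<forall>a\<in>U. \<exists>\<beta>. test_function U \<beta> \<and> (\<forall>x. 0 \<le> \<beta> x) \<and> 0 < \<beta> a"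
    using bump_at[OF assms] by metis
  then obtain \<beta> where \<beta>: "\<And>a. a \<in> U \<Longrightarrow> test_function U (\<beta> a)"
      "\<And>a x. a \<in> U \<Longrightarrow> 0 \<le> \<beta> a x" "\<And>a. a \<in> U \<Longrightarrow> 0 < \<beta> a a"
    by metis
  define F where "F = (\<lambda>a. {x. 0 < \<beta> a x}) ` U"
  have "open S" if "S \<in> F" for S
    using that \<beta>(1) unfolding F_def
    by (auto intro!: open_Collect_less continuous_on_const smooth_on_imp_continuous_on
        dest: test_function_smooth)
  then obtain F' where F': "F' \<subseteq> F" "countable F'" "\<Union>F' = \<Union>F"
    using Lindelof by metis
  then obtain C where C: "C \<subseteq> U" "countable C" "F' = (\<lambda>a. {x. 0 < \<beta> a x}) ` C"
    unfolding F_def using countable_subset_image by metis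
  have cover: "\<exists>a\<in>C. 0 < \<beta> a x" if "x \<in> U" for x
  proof -
    have "x \<in> \<Union>F" using that \<beta>(3) by (auto simp: F_def)
    then show ?thesis using F'(3) C(3) by auto
  qed
  define I where "I n = {a \<in> C. to_nat_on C a < n}" for n
  have fin: "finite (I n)" for n
    unfolding I_def
    by (rule finite_imageD[of "to_nat_on C"])
      (auto intro: finite_subset[of _ "{..<n}"] inj_on_subset[OF inj_on_to_nat_on[OF C(2)]])
  define S where "S n x = (\<Sum>a\<in>I n. \<beta> a x)" for n x
  have S_test: "test_function U (\<lambda>x. S n x * real n)" for n
    unfolding S_def
    by (intro test_function_mult test_function_sum fin smooth_on_const \<beta>) (use C in \<open>auto simp: I_def\<close>)
  define \<theta> where "\<theta> n x = flat_exp 1 (S n x * real n)" for n x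
  show ?thesis
  proof (rule that[of \<theta>])
    show "test_function U (\<theta> n)" for n
      unfolding \<theta>_def [abs_def]
      by (rule test_function_compose_real[OF S_test smooth_on_flat_exp]) (simp add: flat_exp_1)
    show "0 \<le> \<theta> n x" "\<theta> n x \<le> 1" for n x
      by (simp_all add: \<theta>_def flat_exp_1_bounds)
    show "(\<lambda>n. \<theta> n x) \<longlonglongrightarrow> 1" if x: "x \<in> U" for x
    proof -
      obtain a where a: "a \<in> C" "0 < \<beta> a x" using cover[OF x] by blast
      have lower: "\<beta> a x \<le> S n x" if "to_nat_on C a < n" for n
        unfolding S_def using that a C \<beta>(2) fin
        by (intro member_le_sum) (auto simp: I_def)
      have "filterlim (\<lambda>n. \<beta> a x * real n) at_top sequentially"
        using a by (intro filterlim_tendsto_pos_mult_at_top[OF tendsto_const]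
            filterlim_real_sequentially) auto
      then have top: "filterlim (\<lambda>n. S n x * real n) at_top sequentially"
        by (rule filterlim_at_top_mono,
            intro eventually_mono[OF eventually_gt_at_top[of "to_nat_on C a"]] mult_right_mono lower)
          simp_all
      have "((\<lambda>t. exp (- 1 / t)) \<longlongrightarrow> exp (0 :: real)) at_top"
        by (intro tendsto_exp tendsto_divide_0[OF tendsto_const]
            filterlim_at_top_imp_at_infinity filterlim_ident)
      moreover have "eventually (\<lambda>t. exp (- 1 / t) = flat_exp 1 t) at_top"
        using eventually_gt_at_top[of 0] by eventually_elim (simp only: flat_exp_1 if_True)
      ultimately have top': "(flat_exp 1 \<longlongrightarrow> exp 0) at_top"
        by (rule Lim_transform_eventually)
      show ?thesis
        unfolding \<theta>_def using filterlim_compose[OF top' top] by simp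
    qed
  qed
qed

section \<open>Green's formula in \<open>W011\<close>\<close>

lemma lborel_integral_translate:
  fixes f :: "'a::euclidean_space \<Rightarrow> real"
  assumes "f \<in> borel_measurable borel"
  shows "(\<integral>x. f (c + x) \<partial>lborel) = (\<integral>x. f x \<partial>lborel)"
  using integral_distr[of "(+) c" lborel borel f] assms by (simp add: lborel_distr_plus)

text \<open>The integral of a translate does not depend on the translation, so the integrals of the
  difference quotients vanish; they converge to the integral of the derivative by dominated
  convergence, the mean value theorem providing the bound.\<close>

lemma integral_derivative_test_function:
  fixes \<phi> :: "'a::euclidean_space \<Rightarrow> real"
  assumes \<phi>: "test_function \<Omega> \<phi>"
  shows "(\<integral>x. frechet_derivative \<phi> (at x) v \<partial>lborel) = 0"
proof -
  let ?D = "\<lambda>x. frechet_derivative \<phi> (at x) v"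
  obtain K where K: "compact K" "\<And>x. x \<notin> K \<Longrightarrow> \<phi> x = 0" and s: "smooth_on \<phi> UNIV"
    using test_functionE[OF \<phi>] by metis
  obtain R where R: "\<And>x. x \<in> K \<Longrightarrow> norm x \<le> R"
    using K(1) compact_imp_bounded bounded_iff by metis
  obtain B where B: "\<And>x. \<bar>?D x\<bar> \<le> B" "0 \<le> B"
    using test_function_bounded[OF test_function_derivative[OF \<phi>]] by metis
  have meas[measurable]: "\<phi> \<in> borel_measurable borel"
    by (intro borel_measurable_continuous_onI smooth_on_imp_continuous_on s)
  have measD[measurable]: "?D \<in> borel_measurable borel"
    by (intro borel_measurable_continuous_onI smooth_on_imp_continuous_on smooth_on_derivative s)
  define F where "F n x = (\<phi> ((1 / real (Suc n)) *\<^sub>R v + x) - \<phi> x) * real (Suc n)" for n x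
  have line: "((\<lambda>t. \<phi> (t *\<^sub>R v + x)) has_field_derivative ?D (t *\<^sub>R v + x)) (at t)" for t x
  proof -
    have "((\<lambda>t. \<phi> (t *\<^sub>R v + x)) has_derivative
        (\<lambda>h. frechet_derivative \<phi> (at (t *\<^sub>R v + x)) (h *\<^sub>R v))) (at t)"
      by (rule has_derivative_compose[where g = \<phi>, OF _ smooth_on_has_derivative[OF s]])
        (auto intro!: derivative_eq_intros)
    moreover have "frechet_derivative \<phi> (at (t *\<^sub>R v + x)) (h *\<^sub>R v) = ?D (t *\<^sub>R v + x) * h" for h
      using linear_cmul[OF has_derivative_linear[OF smooth_on_has_derivative[OF s]]]
      by (simp add: mult.commute)
    ultimately show ?thesis by (simp add: has_field_derivative_def)
  qed
  have bound: "\<bar>F n x\<bar> \<le> B * indicator (cball 0 (\<bar>R\<bar> + norm v)) x" for n x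
  proof (cases "x \<in> cball 0 (\<bar>R\<bar> + norm v)")
    case True
    let ?h = "1 / real (Suc n)"
    have "0 < ?h" by simp
    from MVT2[OF this, of "\<lambda>t. \<phi> (t *\<^sub>R v + x)" "\<lambda>t. ?D (t *\<^sub>R v + x)"] line
    obtain z where "\<phi> (?h *\<^sub>R v + x) - \<phi> (0 *\<^sub>R v + x) = (?h - 0) * ?D (z *\<^sub>R v + x)"
      by blast
    then have "F n x = ?D (z *\<^sub>R v + x)"
      by (simp add: F_def)
    then show ?thesis using True B by simp
  next
    case False
    then have x: "\<bar>R\<bar> + norm v < norm x" by simp
    then have "x \<notin> K" using R[of x] norm_ge_zero[of v] by linarith
    moreover have "(1 / real (Suc n)) *\<^sub>R v + x \<notin> K"
    proof
      assume "(1 / real (Suc n)) *\<^sub>R v + x \<in> K"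
      then have "norm ((1 / real (Suc n)) *\<^sub>R v + x) \<le> \<bar>R\<bar>" using R by fastforce
      moreover have "norm ((1 / real (Suc n)) *\<^sub>R v) \<le> norm v"
        by (simp add: field_simps mult_le_cancel_left1)
      moreover have "norm x \<le> norm ((1 / real (Suc n)) *\<^sub>R v + x) + norm ((1 / real (Suc n)) *\<^sub>R v)"
        by (metis add_diff_cancel_left' norm_triangle_sub norm_triangle_ineq4)
      ultimately show False using x by linarith
    qed
    ultimately show ?thesis using K(2) B by (simp add: F_def)
  qed
  have lim: "(\<lambda>n. F n x) \<longlonglongrightarrow> ?D x" for x
  proof -
    have "((\<lambda>h. (\<phi> (h *\<^sub>R v + x) - \<phi> x) / h) \<longlongrightarrow> ?D x) (at 0)"
      using line[of x 0] by (simp add: has_field_derivative_iff)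
    moreover have "filterlim (\<lambda>n. 1 / real (Suc n)) (at 0) sequentially"
      unfolding filterlim_at
      by (intro conjI LIMSEQ_Suc[OF lim_1_over_n] always_eventually allI) auto
    ultimately have "(\<lambda>n. (\<phi> ((1 / real (Suc n)) *\<^sub>R v + x) - \<phi> x) / (1 / real (Suc n))) \<longlonglongrightarrow> ?D x"
      by (rule filterlim_compose)
    then show ?thesis by (simp add: F_def)
  qed
  have "(\<lambda>n. \<integral>x. F n x \<partial>lborel) \<longlonglongrightarrow> (\<integral>x. ?D x \<partial>lborel)"
  proof (rule integral_dominated_convergence[where w = "\<lambda>x. B * indicator (cball 0 (\<bar>R\<bar> + norm v)) x"])
    show "integrable lborel (\<lambda>x. B * indicator (cball 0 (\<bar>R\<bar> + norm v)) x :: real)"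
      using borel_integrable_compact[OF compact_cball continuous_on_const[of _ B]]
      by (simp add: mult.commute)
    show "F n \<in> borel_measurable lborel" for n
      unfolding F_def [abs_def] by measurable
  qed (use bound lim in \<open>auto\<close>)
  moreover have "(\<integral>x. F n x \<partial>lborel) = 0" for n
  proof -
    have i: "integrable lborel \<phi>" by (rule test_function_integrable[OF \<phi>])
    then have "integrable lborel (\<lambda>x. \<phi> ((1 / real (Suc n)) *\<^sub>R v + x))"
      using integrable_distr[of "(+) ((1 / real (Suc n)) *\<^sub>R v)" lborel borel \<phi>]
      by (simp add: lborel_distr_plus)
    with i show ?thesis
      unfolding F_def by (simp add: lborel_integral_translate)
  qed
  ultimately show ?thesis
    by (simp add: LIMSEQ_const_iff)
qed

lemma set_integrable_inner_bounded:
  fixes f m :: "'a::euclidean_space \<Rightarrow> 'b::euclidean_space"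
  assumes f: "set_integrable lebesgue \<Omega> f" and m: "continuous_on UNIV m"
    and B: "\<And>x. x \<in> \<Omega> \<Longrightarrow> norm (m x) \<le> B"
  shows "set_integrable lebesgue \<Omega> (\<lambda>x. f x \<bullet> m x)"
  unfolding set_integrable_def
proof (rule Bochner_Integration.integrable_bound)
  have F: "integrable lebesgue (\<lambda>x. indicator \<Omega> x *\<^sub>R f x)"
    using f by (simp add: set_integrable_def)
  then show "integrable lebesgue (\<lambda>x. B * norm (indicator \<Omega> x *\<^sub>R f x))"
    by (intro integrable_mult_right integrable_norm)
  have "m \<in> borel_measurable lebesgue"
    by (rule measurable_completion) (use m in \<open>simp add: borel_measurable_continuous_onI\<close>)
  then have "(\<lambda>x. (indicator \<Omega> x *\<^sub>R f x) \<bullet> m x) \<in> borel_measurable lebesgue"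
    by (intro borel_measurable_inner borel_measurable_integrable[OF F])
  then show "(\<lambda>x. indicator \<Omega> x *\<^sub>R (f x \<bullet> m x)) \<in> borel_measurable lebesgue"
    by simp
  have le: "\<bar>f x \<bullet> m x\<bar> \<le> B * norm (f x)" if "x \<in> \<Omega>" for x
    using order_trans[OF Cauchy_Schwarz_ineq2 mult_left_mono[OF B[OF that] norm_ge_zero]]
    by (simp add: mult.commute)
  then show "AE x in lebesgue. norm (indicator \<Omega> x *\<^sub>R (f x \<bullet> m x))
      \<le> norm (B * norm (indicator \<Omega> x *\<^sub>R f x))"
  proof (intro AE_I2)
    fix x
    show "norm (indicator \<Omega> x *\<^sub>R (f x \<bullet> m x)) \<le> norm (B * norm (indicator \<Omega> x *\<^sub>R f x))"
      using le[of x] by (cases "x \<in> \<Omega>") auto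
  qed
qed

lemma set_integral_inner_tendsto:
  fixes f m :: "'a::euclidean_space \<Rightarrow> 'b::euclidean_space"
  assumes f: "set_integrable lebesgue \<Omega> f" and fk: "\<And>k. set_integrable lebesgue \<Omega> (fk k)"
    and m: "continuous_on UNIV m" and B: "\<And>x. x \<in> \<Omega> \<Longrightarrow> norm (m x) \<le> B"
    and lim: "(\<lambda>k. LINT x:\<Omega>|lebesgue. norm (fk k x - f x)) \<longlonglongrightarrow> 0"
  shows "(\<lambda>k. LINT x:\<Omega>|lebesgue. fk k x \<bullet> m x) \<longlonglongrightarrow> (LINT x:\<Omega>|lebesgue. f x \<bullet> m x)"
proof (rule Lim_null[THEN iffD2], rule Lim_null_comparison)
  have d: "set_integrable lebesgue \<Omega> (\<lambda>x. fk k x - f x)" for k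
    by (intro set_integral_diff fk f)
  show "(\<lambda>k. \<bar>B\<bar> * (LINT x:\<Omega>|lebesgue. norm (fk k x - f x))) \<longlonglongrightarrow> 0"
    using tendsto_mult_right_zero[OF lim] by simp
  have "norm ((LINT x:\<Omega>|lebesgue. fk k x \<bullet> m x) - (LINT x:\<Omega>|lebesgue. f x \<bullet> m x))
      \<le> \<bar>B\<bar> * (LINT x:\<Omega>|lebesgue. norm (fk k x - f x))" for k
  proof -
    have "(LINT x:\<Omega>|lebesgue. fk k x \<bullet> m x) - (LINT x:\<Omega>|lebesgue. f x \<bullet> m x)
        = (LINT x:\<Omega>|lebesgue. (fk k x - f x) \<bullet> m x)"
      by (subst set_integral_diff(2)[symmetric])
        (auto intro: set_integrable_inner_bounded f fk m B simp: inner_diff_left)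
    also have "norm \<dots> \<le> (LINT x:\<Omega>|lebesgue. \<bar>B\<bar> * norm (fk k x - f x))"
    proof (rule set_integral_norm_bound[THEN order_trans])
      show i: "set_integrable lebesgue \<Omega> (\<lambda>x. (fk k x - f x) \<bullet> m x)"
        by (rule set_integrable_inner_bounded[OF d m B])
      have "\<bar>(fk k x - f x) \<bullet> m x\<bar> \<le> \<bar>B\<bar> * norm (fk k x - f x)" if "x \<in> \<Omega>" for x
      proof -
        have "norm (m x) \<le> \<bar>B\<bar>" using B[OF that] by linarith
        from order_trans[OF Cauchy_Schwarz_ineq2 mult_left_mono[OF this norm_ge_zero]]
        show ?thesis by (simp add: mult.commute)
      qed
      then show "(LINT x:\<Omega>|lebesgue. norm ((fk k x - f x) \<bullet> m x))
          \<le> (LINT x:\<Omega>|lebesgue. \<bar>B\<bar> * norm (fk k x - f x))"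
        by (intro set_integral_mono set_integrable_norm[OF i] set_integrable_mult_right
            set_integrable_norm[OF d]) auto
    qed
    finally show ?thesis by simp
  qed
  then show "\<forall>\<^sub>F k in sequentially. norm ((LINT x:\<Omega>|lebesgue. fk k x \<bullet> m x) - (LINT x:\<Omega>|lebesgue. f x \<bullet> m x))
      \<le> \<bar>B\<bar> * (LINT x:\<Omega>|lebesgue. norm (fk k x - f x))"
    by simp
qed

lemma set_integrable_test_function:
  assumes "test_function \<Omega> \<phi>"
  shows "set_integrable lebesgue \<Omega> \<phi>" 
    "(LINT x:\<Omega>|lebesgue. \<phi> x) = (LINT x|lborel. \<phi> x)"
proof -
  have eq: "(\<lambda>x. indicator \<Omega> x *\<^sub>R \<phi> x) = \<phi>"
    using test_function_eq_0[OF assms] by (auto simp: indicator_def fun_eq_iff)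
  have i: "integrable lborel \<phi>" by (rule test_function_integrable[OF assms])
  show "set_integrable lebesgue \<Omega> \<phi>"
    unfolding set_integrable_def eq
    by (subst integrable_completion) (use i in auto)
  show "(LINT x:\<Omega>|lebesgue. \<phi> x) = (LINT x|lborel. \<phi> x)"
    unfolding set_lebesgue_integral_def eq
    by (rule integral_completion) (use i in auto)
qed

lemma set_integrable_sum':
  fixes f :: "'i \<Rightarrow> 'a::euclidean_space \<Rightarrow> 'b::euclidean_space"
  assumes "\<And>i. i \<in> I \<Longrightarrow> set_integrable M \<Omega> (f i)"
  shows "set_integrable M \<Omega> (\<lambda>x. \<Sum>i\<in>I. f i x)"
    and "(LINT x:\<Omega>|M. \<Sum>i\<in>I. f i x) = (\<Sum>i\<in>I. LINT x:\<Omega>|M. f i x)"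
  using assms unfolding set_integrable_def set_lebesgue_integral_def scaleR_sum_right
  by (auto intro: Bochner_Integration.integral_sum)

lemma green_test_function:
  fixes \<phi> \<psi> :: "'a::euclidean_space \<Rightarrow> real"
  assumes \<phi>: "test_function \<Omega> \<phi>" and \<psi>: "smooth_on \<psi> UNIV"
  shows "(LINT x:\<Omega>|lebesgue. grad \<phi> x \<bullet> grad \<psi> x) = - (LINT x:\<Omega>|lebesgue. \<phi> x * laplacian \<psi> x)"
proof -
  have g: "test_function \<Omega> (\<lambda>x. grad \<phi> x \<bullet> grad \<psi> x)"
    unfolding grad_inner_grad
    by (intro test_function_sum test_function_mult test_function_derivative \<phi>
        smooth_on_derivative \<psi>) auto
  have l: "test_function \<Omega> (\<lambda>x. \<phi> x * laplacian \<psi> x)"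
    by (intro test_function_mult \<phi> smooth_on_laplacian \<psi>)
  have t: "test_function \<Omega> (\<lambda>x. \<phi> x * frechet_derivative \<psi> (at x) b)" for b
    by (intro test_function_mult \<phi> smooth_on_derivative \<psi>)
  have "(LINT x:\<Omega>|lebesgue. grad \<phi> x \<bullet> grad \<psi> x) + (LINT x:\<Omega>|lebesgue. \<phi> x * laplacian \<psi> x)
      = (\<integral>x. (grad \<phi> x \<bullet> grad \<psi> x + \<phi> x * laplacian \<psi> x) \<partial>lborel)"
    using test_function_integrable[OF g] test_function_integrable[OF l]
    by (simp add: set_integrable_test_function[OF g] set_integrable_test_function[OF l])
  also have "\<dots> = (\<integral>x. (\<Sum>b\<in>Basis.
      frechet_derivative (\<lambda>y. \<phi> y * frechet_derivative \<psi> (at y) b) (at x) b) \<partial>lborel)"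
    by (intro Bochner_Integration.integral_cong refl)
      (simp add: grad_inner_grad laplacian_def frechet_derivative_mult smooth_on_derivative \<psi>
        test_function_smooth[OF \<phi>] sum_distrib_left sum.distrib add.commute)
  also have "\<dots> = 0"
    by (subst Bochner_Integration.integral_sum)
      (auto intro!: test_function_integrable test_function_derivative t
        simp: integral_derivative_test_function[OF t])
  finally show ?thesis by simp
qed

lemma bounded_on_bounded:
  fixes m :: "'a::euclidean_space \<Rightarrow> 'b::real_normed_vector"
  assumes "continuous_on UNIV m" "bounded \<Omega>"
  obtains B where "\<And>x. x \<in> \<Omega> \<Longrightarrow> norm (m x) \<le> B"
proof -
  have "compact (m ` closure \<Omega>)"
    using assms by (intro compact_continuous_image) (auto intro: continuous_on_subset)
  then show ?thesis
    using that closure_subset by (metis bounded_iff compact_imp_bounded imageI subsetD)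
qed

text \<open>The definition of a weak gradient only speaks about compactly supported functions. Multiplying
  the components of \<open>grad \<psi>\<close> by an exhausting sequence of test functions and passing to the limit
  extends the uniqueness to pairings with functions that are smooth up to the boundary.\<close>

lemma weak_gradient_pairing_unique:
  assumes "open \<Omega>" "bounded \<Omega>" "W11_gradient \<Omega> w g" "W11_gradient \<Omega> w g'" and \<psi>: "smooth_on \<psi> UNIV"
  shows "(LINT x:\<Omega>|lebesgue. g x \<bullet> grad \<psi> x) = (LINT x:\<Omega>|lebesgue. g' x \<bullet> grad \<psi> x)"
proof -
  obtain \<theta> :: "nat \<Rightarrow> 'a \<Rightarrow> real" where \<theta>: "\<And>n. test_function \<Omega> (\<theta> n)"
    "\<And>n x. 0 \<le> \<theta> n x" "\<And>n x. \<theta> n x \<le> 1" "\<And>x. x \<in> \<Omega> \<Longrightarrow> (\<lambda>n. \<theta> n x) \<longlonglongrightarrow> 1"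
    using test_function_exhaustion[OF assms(1)] by metis
  let ?c = "\<lambda>b x. frechet_derivative \<psi> (at x) b"
  have cont: "continuous_on UNIV (?c b)" for b
    by (intro smooth_on_imp_continuous_on smooth_on_derivative \<psi>)
  have comp: "set_integrable lebesgue \<Omega> (\<lambda>x. f x \<bullet> b)" if "W11_gradient \<Omega> w f" for f b
    using that unfolding W11_gradient_def set_integrable_def by (simp flip: inner_scaleR_left)
  have int: "set_integrable lebesgue \<Omega> (\<lambda>x. (f x \<bullet> b) * ?c b x)" if "W11_gradient \<Omega> w f" for f b
  proof -
    obtain B where "\<And>x. x \<in> \<Omega> \<Longrightarrow> norm (?c b x) \<le> B"
      using bounded_on_bounded[OF cont assms(2)] by metis
    from set_integrable_inner_bounded[OF comp[OF that] cont this]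
    show ?thesis by simp
  qed
  have lim: "(\<lambda>n. LINT x:\<Omega>|lebesgue. (f x \<bullet> b) * (\<theta> n x * ?c b x)) \<longlonglongrightarrow> (LINT x:\<Omega>|lebesgue. (f x \<bullet> b) * ?c b x)"
    if f: "W11_gradient \<Omega> w f" for f b
    unfolding set_lebesgue_integral_def
  proof (rule integral_dominated_convergence)
    note i = int[OF f, of b, unfolded set_integrable_def]
    have m[measurable]: "\<theta> n \<in> borel_measurable lebesgue" for n
      by (rule measurable_completion)
        (simp add: borel_measurable_continuous_onI smooth_on_imp_continuous_on
          test_function_smooth[OF \<theta>(1)])
    show "integrable lebesgue (\<lambda>x. norm (indicator \<Omega> x *\<^sub>R (f x \<bullet> b * ?c b x)))"
      by (intro integrable_norm i)
    show "(\<lambda>x. indicator \<Omega> x *\<^sub>R (f x \<bullet> b * ?c b x)) \<in> borel_measurable lebesgue"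
      using i by simp
    have "(\<lambda>x. \<theta> n x * (indicator \<Omega> x *\<^sub>R (f x \<bullet> b * ?c b x))) \<in> borel_measurable lebesgue" for n
      by (intro borel_measurable_times m borel_measurable_integrable[OF i])
    then show "(\<lambda>x. indicator \<Omega> x *\<^sub>R (f x \<bullet> b * (\<theta> n x * ?c b x))) \<in> borel_measurable lebesgue" for n
      by (simp add: mult_ac)
    show "AE x in lebesgue. norm (indicator \<Omega> x *\<^sub>R (f x \<bullet> b * (\<theta> n x * ?c b x)))
        \<le> norm (indicator \<Omega> x *\<^sub>R (f x \<bullet> b * ?c b x))" for n
    proof (intro AE_I2)
      fix x
      have "\<bar>\<theta> n x\<bar> * \<bar>f x \<bullet> b * ?c b x\<bar> \<le> 1 * \<bar>f x \<bullet> b * ?c b x\<bar>"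
        using \<theta>(2,3)[of n x] by (intro mult_right_mono) auto
      then show "norm (indicator \<Omega> x *\<^sub>R (f x \<bullet> b * (\<theta> n x * ?c b x)))
        \<le> norm (indicator \<Omega> x *\<^sub>R (f x \<bullet> b * ?c b x))"
        by (auto simp: indicator_def abs_mult mult_ac)
    qed
    show "AE x in lebesgue. (\<lambda>n. indicator \<Omega> x *\<^sub>R (f x \<bullet> b * (\<theta> n x * ?c b x)))
        \<longlonglongrightarrow> indicator \<Omega> x *\<^sub>R (f x \<bullet> b * ?c b x)"
    proof (intro AE_I2)
      fix x
      show "(\<lambda>n. indicator \<Omega> x *\<^sub>R (f x \<bullet> b * (\<theta> n x * ?c b x)))
        \<longlonglongrightarrow> indicator \<Omega> x *\<^sub>R (f x \<bullet> b * ?c b x)"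
      proof (cases "x \<in> \<Omega>")
        case True
        have "(\<lambda>n. f x \<bullet> b * (\<theta> n x * ?c b x)) \<longlonglongrightarrow> f x \<bullet> b * (1 * ?c b x)"
          by (intro tendsto_intros \<theta>(4) True)
        with True show ?thesis by simp
      qed simp
    qed
  qed
  have eq: "(LINT x:\<Omega>|lebesgue. (g x \<bullet> b) * ?c b x) = (LINT x:\<Omega>|lebesgue. (g' x \<bullet> b) * ?c b x)"
    if b: "b \<in> Basis" for b
  proof -
    have t: "test_function \<Omega> (\<lambda>x. \<theta> n x * ?c b x)" for n
      by (intro test_function_mult \<theta> smooth_on_derivative \<psi>)
    have weak: "(LINT x:\<Omega>|lebesgue. w x * (grad (\<lambda>x. \<theta> n x * ?c b x) x \<bullet> b))
        = - (LINT x:\<Omega>|lebesgue. (f x \<bullet> b) * (\<theta> n x * ?c b x))"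
      if f: "W11_gradient \<Omega> w f" for f n
    proof -
      from f have "has_weak_gradient \<Omega> w f" by (simp add: W11_gradient_def)
      then show ?thesis unfolding has_weak_gradient_def using t[of n] b by blast
    qed
    have "(LINT x:\<Omega>|lebesgue. (g x \<bullet> b) * (\<theta> n x * ?c b x))
        = (LINT x:\<Omega>|lebesgue. (g' x \<bullet> b) * (\<theta> n x * ?c b x))" for n
      using weak[OF assms(3), of n] weak[OF assms(4), of n] by linarith
    then show ?thesis
      using LIMSEQ_unique[OF lim[OF assms(3), of b]] lim[OF assms(4), of b] by simp
  qed
  have "(LINT x:\<Omega>|lebesgue. f x \<bullet> grad \<psi> x) = (\<Sum>b\<in>Basis. LINT x:\<Omega>|lebesgue. (f x \<bullet> b) * ?c b x)"
    if "W11_gradient \<Omega> w f" for f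
  proof -
    have "(LINT x:\<Omega>|lebesgue. f x \<bullet> grad \<psi> x) = (LINT x:\<Omega>|lebesgue. \<Sum>b\<in>Basis. (f x \<bullet> b) * ?c b x)"
      by (simp add: inner_commute[of _ "grad \<psi> _"] grad_inner mult.commute)
    then show ?thesis by (simp add: set_integrable_sum'(2)[OF int[OF that]])
  qed
  with assms(3,4) eq show ?thesis by simp
qed

text \<open>No boundary term appears because \<open>w\<close> is a limit of test functions, for which the formula is
  \<open>green_test_function\<close>. The gradient that the approximation converges to need not be \<open>g\<close> itself,
  but pairs in the same way.\<close>

lemma W011_green:
  assumes "open \<Omega>" "bounded \<Omega>" "w \<in> W011 \<Omega>" "W11_gradient \<Omega> w g" and \<psi>: "smooth_on \<psi> UNIV"
  shows "(LINT x:\<Omega>|lebesgue. g x \<bullet> grad \<psi> x) = - (LINT x:\<Omega>|lebesgue. w x * laplacian \<psi> x)"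
proof -
  obtain g' \<phi> where g': "W11_gradient \<Omega> w g'" and \<phi>: "\<And>k. test_function \<Omega> (\<phi> k)"
    and lim: "(\<lambda>k. (LINT x:\<Omega>|lebesgue. \<bar>\<phi> k x - w x\<bar>) + (LINT x:\<Omega>|lebesgue. norm (grad (\<phi> k) x - g' x))) \<longlonglongrightarrow> 0"
    using assms(3) unfolding W011_def by blast
  have w: "set_integrable lebesgue \<Omega> w" and g'i: "set_integrable lebesgue \<Omega> g'"
    using g' unfolding W11_gradient_def by auto
  have nn: "0 \<le> (LINT x:\<Omega>|lebesgue. norm (f x))" for f :: "'a \<Rightarrow> 'c::real_normed_vector"
    unfolding set_lebesgue_integral_def by (intro integral_nonneg_AE AE_I2) simp
  have lim1: "(\<lambda>k. LINT x:\<Omega>|lebesgue. norm (\<phi> k x - w x)) \<longlonglongrightarrow> 0"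
    by (rule tendsto_sandwich[OF _ _ tendsto_const lim]) (auto intro!: always_eventually nn simp flip: real_norm_def)
  have lim2: "(\<lambda>k. LINT x:\<Omega>|lebesgue. norm (grad (\<phi> k) x - g' x)) \<longlonglongrightarrow> 0"
    by (rule tendsto_sandwich[OF _ _ tendsto_const lim]) (auto intro!: always_eventually nn simp flip: real_norm_def)
  have gi: "set_integrable lebesgue \<Omega> (grad (\<phi> k))" for k
    unfolding grad_def [abs_def]
  proof (rule set_integrable_sum'(1))
    fix b
    have "set_integrable lebesgue \<Omega> (\<lambda>x. frechet_derivative (\<phi> k) (at x) b)"
      by (rule set_integrable_test_function(1)[OF test_function_derivative[OF \<phi>]])
    then have "integrable lebesgue (\<lambda>x. (indicator \<Omega> x *\<^sub>R frechet_derivative (\<phi> k) (at x) b) *\<^sub>R b)"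
      unfolding set_integrable_def by (intro integrable_scaleR_left)
    then show "set_integrable lebesgue \<Omega> (\<lambda>x. frechet_derivative (\<phi> k) (at x) b *\<^sub>R b)"
      by (simp add: set_integrable_def)
  qed
  have cl: "continuous_on UNIV (laplacian \<psi>)"
    by (intro smooth_on_imp_continuous_on smooth_on_laplacian \<psi>)
  obtain B1 B2 where B: "\<And>x. x \<in> \<Omega> \<Longrightarrow> norm (laplacian \<psi> x) \<le> B1" "\<And>x. x \<in> \<Omega> \<Longrightarrow> norm (grad \<psi> x) \<le> B2"
    using bounded_on_bounded[OF cl assms(2)] bounded_on_bounded[OF continuous_on_grad[OF \<psi>] assms(2)]
    by metis
  have "(\<lambda>k. LINT x:\<Omega>|lebesgue. grad (\<phi> k) x \<bullet> grad \<psi> x) \<longlonglongrightarrow> (LINT x:\<Omega>|lebesgue. g' x \<bullet> grad \<psi> x)"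
    by (rule set_integral_inner_tendsto[OF g'i gi continuous_on_grad[OF \<psi>] B(2) lim2])
  moreover have "(\<lambda>k. LINT x:\<Omega>|lebesgue. \<phi> k x * laplacian \<psi> x) \<longlonglongrightarrow> (LINT x:\<Omega>|lebesgue. w x * laplacian \<psi> x)"
    using set_integral_inner_tendsto[OF w set_integrable_test_function(1)[OF \<phi>] cl B(1) lim1] by simp
  ultimately have "(LINT x:\<Omega>|lebesgue. g' x \<bullet> grad \<psi> x) = - (LINT x:\<Omega>|lebesgue. w x * laplacian \<psi> x)"
    unfolding green_test_function[OF \<phi> \<psi>] using LIMSEQ_unique tendsto_minus by blast
  then show ?thesis
    using weak_gradient_pairing_unique[OF assms(1,2,4) g' \<psi>] by simp
qed

section \<open>The height above a local boundary graph\<close>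

lemma grad_inner_eq_derivative:
  assumes "smooth_on f UNIV"
  shows "grad f x \<bullet> v = frechet_derivative f (at x) v"
proof -
  have lin: "linear (frechet_derivative f (at x))"
    by (rule has_derivative_linear[OF smooth_on_has_derivative[OF assms]])
  have "frechet_derivative f (at x) v = frechet_derivative f (at x) (\<Sum>b\<in>Basis. (v \<bullet> b) *\<^sub>R b)"
    by (simp add: euclidean_representation)
  also have "\<dots> = grad f x \<bullet> v"
    by (simp add: linear_sum[OF lin] linear_cmul[OF lin] grad_inner mult.commute)
  finally show ?thesis by simp
qed

text \<open>Signed height, measured along \<open>e\<close>, above the graph of \<open>\<gamma>\<close>. Near a boundary point it replaces
  the distance to the boundary: it is smooth, dominates the distance inside \<open>\<Omega>\<close>
  and increases with unit speed along \<open>e\<close>.\<close>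

definition graph_height :: "'a::euclidean_space \<Rightarrow> ('a \<Rightarrow> real) \<Rightarrow> 'a \<Rightarrow> real" where
  "graph_height e \<gamma> x = x \<bullet> e - \<gamma> (x - (x \<bullet> e) *\<^sub>R e)"

lemma bounded_linear_proj: "bounded_linear (\<lambda>x::'a::euclidean_space. x - (x \<bullet> e) *\<^sub>R e)"
  by (intro bounded_linear_sub bounded_linear_ident
      bounded_linear_compose[OF bounded_linear_scaleR_left bounded_linear_inner_left])

lemma smooth_on_graph_height: "smooth_on \<gamma> UNIV \<Longrightarrow> smooth_on (graph_height e \<gamma>) UNIV"
  unfolding graph_height_def [abs_def]
  by (rule smooth_on_diff[OF smooth_on_inner smooth_on_compose_linear[OF _ bounded_linear_proj]])

lemma graph_height_shift:
  assumes "norm e = 1"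
  shows "graph_height e \<gamma> (x - t *\<^sub>R e) = graph_height e \<gamma> x - t"
proof -
  have "e \<bullet> e = 1" using assms by (simp add: dot_square_norm)
  then show ?thesis by (simp add: graph_height_def inner_diff_left algebra_simps)
qed

lemma norm_grad_graph_height:
  assumes e: "norm e = 1" and \<gamma>: "smooth_on \<gamma> UNIV"
  shows "1 \<le> norm (grad (graph_height e \<gamma>) x)"
proof -
  note s = smooth_on_graph_height[OF \<gamma>, of e]
  have "((\<lambda>t. graph_height e \<gamma> (x - t *\<^sub>R e)) has_derivative
      (\<lambda>t. frechet_derivative (graph_height e \<gamma>) (at (x - 0 *\<^sub>R e)) (- (t *\<^sub>R e)))) (at 0)"
    by (rule has_derivative_compose[where g = "graph_height e \<gamma>", OF _ smooth_on_has_derivative[OF s]])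
      (auto intro!: derivative_eq_intros)
  moreover have "((\<lambda>t. graph_height e \<gamma> (x - t *\<^sub>R e)) has_derivative (\<lambda>t. - t)) (at 0)"
    unfolding graph_height_shift[OF e] by (auto intro!: derivative_eq_intros)
  ultimately have "frechet_derivative (graph_height e \<gamma>) (at (x - 0 *\<^sub>R e)) (- ((-1) *\<^sub>R e)) = - (-1)"
    using has_derivative_unique by metis
  then have "grad (graph_height e \<gamma>) x \<bullet> e = 1"
    by (simp add: grad_inner_eq_derivative[OF s])
  then show ?thesis
    using norm_cauchy_schwarz[of "grad (graph_height e \<gamma>) x" e] e by simp
qed

section \<open>The barrier\<close>

lemma flat_exp_1_derivs:
  "deriv (flat_exp 1) t = (if 0 < t then exp (- 1 / t) / t\<^sup>2 else 0)"
  "deriv (deriv (flat_exp 1)) t = (if 0 < t then exp (- 1 / t) * (1 - 2 * t) / t ^ 4 else 0)"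
proof -
  have p: "pderiv (1 :: real poly) = 0" by simp
  show "deriv (flat_exp 1) t = (if 0 < t then exp (- 1 / t) / t\<^sup>2 else 0)"
    unfolding deriv_flat_exp p by (auto simp: flat_exp_def power2_eq_square)
  show "deriv (deriv (flat_exp 1)) t = (if 0 < t then exp (- 1 / t) * (1 - 2 * t) / t ^ 4 else 0)"
    unfolding deriv_flat_exp p
    by (auto simp: flat_exp_def pderiv_pCons pderiv_mult field_simps power2_eq_square power4_eq_xxxx)
qed

text \<open>This controls the pole \<open>1 / s ^ 4\<close> in the second derivative of the flat exponential. The constant
  is \<open>4 ^ 4\<close>, from \<open>(1 + y / 4) ^ 4 \<le> exp y\<close>.\<close>

lemma exp_neg_inverse_le:
  assumes "0 < (s::real)"
  shows "exp (- 1 / s) \<le> 256 * s ^ 4"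
proof -
  have "(1 / s / 4) ^ 4 \<le> (1 + 1 / s / real 4) ^ 4"
    using assms by (intro power_mono) auto
  also have "\<dots> \<le> exp (1 / s)"
    by (rule exp_ge_one_plus_x_over_n_power_n) (use assms in \<open>auto intro: order_trans[of _ 0]\<close>)
  finally have "1 / (256 * s ^ 4) \<le> exp (1 / s)"
    by (simp add: power_divide)
  then have "inverse (exp (1 / s)) \<le> inverse (1 / (256 * s ^ 4))"
    using assms by (intro le_imp_inverse_le) auto
  then show ?thesis by (simp add: exp_minus)
qed

text \<open>The profile \<open>exp (- 1 / s)\<close> with \<open>s = (1 - \<rho> / \<epsilon>) / 4\<close> is positive exactly on \<open>\<rho> < \<epsilon>\<close>. It is convex
  for \<open>s \<le> 1 / 2\<close>; since \<open>s \<le> 1 / 4\<close> on \<open>\<rho> \<ge> 0\<close>, the second derivative is there even at least half of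
  \<open>exp (- 1 / s) / s ^ 4\<close>. The cutoff enters as a square so that its gradient is
  controlled by the cutoff itself.\<close>

definition barrier :: "('a \<Rightarrow> real) \<Rightarrow> ('a \<Rightarrow> real) \<Rightarrow> real \<Rightarrow> 'a \<Rightarrow> real" where
  "barrier \<zeta> \<rho> \<epsilon> x = (\<zeta> x * \<zeta> x) * flat_exp 1 (1 / 4 - \<rho> x / (4 * \<epsilon>))"

lemma laplacian_barrier:
  fixes \<zeta> \<rho> :: "'a::euclidean_space \<Rightarrow> real" and \<epsilon> :: real
  assumes \<zeta>: "smooth_on \<zeta> UNIV" and \<rho>: "smooth_on \<rho> UNIV"
  defines "s x \<equiv> 1 / 4 - \<rho> x / (4 * \<epsilon>)"
  shows "smooth_on (barrier \<zeta> \<rho> \<epsilon>) UNIV"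
    and "laplacian (barrier \<zeta> \<rho> \<epsilon>) x =
      (\<zeta> x)\<^sup>2 * (deriv (deriv (flat_exp 1)) (s x) * (norm (grad \<rho> x))\<^sup>2 / (4 * \<epsilon>)\<^sup>2
        - deriv (flat_exp 1) (s x) * laplacian \<rho> x / (4 * \<epsilon>))
      - 4 * \<zeta> x * deriv (flat_exp 1) (s x) * (grad \<zeta> x \<bullet> grad \<rho> x) / (4 * \<epsilon>)
      + laplacian (\<lambda>x. \<zeta> x * \<zeta> x) x * flat_exp 1 (s x)"
proof -
  define \<delta> where "\<delta> = 1 / (4 * \<epsilon>)"
  define G where "G t = flat_exp 1 (1 / 4 - t * \<delta>)" for t
  have G: "smooth_on G UNIV"
    unfolding G_def [abs_def]
    by (rule smooth_on_compose_real[OF smooth_on_flat_exp])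
      (intro smooth_on_diff smooth_on_mult smooth_on_const smooth_on_bounded_linear bounded_linear_ident)
  have dF: "(flat_exp P has_field_derivative deriv (flat_exp P) t) (at t)" for P t
    using flat_exp_has_derivative[of P t] by (simp add: deriv_flat_exp)
  have aff: "((\<lambda>t. 1 / 4 - t * \<delta>) has_field_derivative - \<delta>) (at t)" for t
    by (auto intro!: derivative_eq_intros)
  have dG: "deriv G t = - \<delta> * deriv (flat_exp 1) (1 / 4 - t * \<delta>)" for t
    unfolding G_def [abs_def]
    using DERIV_imp_deriv[OF DERIV_chain2[OF dF aff]] by (simp add: mult.commute)
  have "deriv (deriv G) t = \<delta>\<^sup>2 * deriv (deriv (flat_exp 1)) (1 / 4 - t * \<delta>)" for t
  proof -
    have "deriv G = (\<lambda>t. - \<delta> * deriv (flat_exp 1) (1 / 4 - t * \<delta>))" using dG by blast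
    moreover have "(deriv (flat_exp 1) has_field_derivative deriv (deriv (flat_exp 1)) t) (at t)" for t
      using dF[of "[:0, 0, 1:] * (1 - pderiv 1)"] by (simp add: deriv_flat_exp)
    from DERIV_imp_deriv[OF DERIV_cmult[OF DERIV_chain2[OF this aff], of "- \<delta>"]]
    have "deriv (\<lambda>t. - \<delta> * deriv (flat_exp 1) (1 / 4 - t * \<delta>)) t
        = - \<delta> * (deriv (deriv (flat_exp 1)) (1 / 4 - t * \<delta>) * - \<delta>)" .
    ultimately show ?thesis by (simp add: power2_eq_square)
  qed
  note dG = dG this
  have eq: "barrier \<zeta> \<rho> \<epsilon> = (\<lambda>x. (\<zeta> x * \<zeta> x) * G (\<rho> x))"
    by (auto simp: barrier_def G_def \<delta>_def)
  have sx: "1 / 4 - \<rho> x * \<delta> = s x" by (simp add: s_def \<delta>_def)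
  note G\<rho> = smooth_on_compose_real[OF G \<rho>]
  show "smooth_on (barrier \<zeta> \<rho> \<epsilon>) UNIV"
    unfolding eq by (intro smooth_on_mult \<zeta> G\<rho>)
  have "laplacian (barrier \<zeta> \<rho> \<epsilon>) x =
      (\<zeta> x)\<^sup>2 * (deriv (deriv (flat_exp 1)) (s x) * (norm (grad \<rho> x))\<^sup>2 * \<delta>\<^sup>2
        - deriv (flat_exp 1) (s x) * laplacian \<rho> x * \<delta>)
      - 4 * \<zeta> x * deriv (flat_exp 1) (s x) * (grad \<zeta> x \<bullet> grad \<rho> x) * \<delta>
      + laplacian (\<lambda>x. \<zeta> x * \<zeta> x) x * flat_exp 1 (s x)"
    unfolding eq laplacian_mult[OF smooth_on_mult[OF \<zeta> \<zeta>] G\<rho>] laplacian_compose_real[OF G \<rho>]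
      grad_compose_real[OF G \<rho>] grad_mult[OF \<zeta> \<zeta>] dG sx
    by (simp add: G_def sx inner_add_left power2_eq_square right_diff_distrib mult.left_commute)
  then show "laplacian (barrier \<zeta> \<rho> \<epsilon>) x =
      (\<zeta> x)\<^sup>2 * (deriv (deriv (flat_exp 1)) (s x) * (norm (grad \<rho> x))\<^sup>2 / (4 * \<epsilon>)\<^sup>2
        - deriv (flat_exp 1) (s x) * laplacian \<rho> x / (4 * \<epsilon>))
      - 4 * \<zeta> x * deriv (flat_exp 1) (s x) * (grad \<zeta> x \<bullet> grad \<rho> x) / (4 * \<epsilon>)
      + laplacian (\<lambda>x. \<zeta> x * \<zeta> x) x * flat_exp 1 (s x)"
    by (simp add: \<delta>_def power_divide)
qed

text \<open>With \<open>a = \<zeta> / (4 \<epsilon> s\<^sup>2)\<close> the Laplacian of the barrier is the quadratic polynomial in \<open>a\<close> below: the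
  convexity of the profile gives the square and all terms of order \<open>1 / \<epsilon>\<close> are linear in \<open>a\<close>.
  Completing the square bounds it from below independently of \<open>a\<close>, hence of \<open>\<epsilon>\<close>.\<close>

lemma quadratic_bounds:
  fixes q s G a Y L A M :: real
  assumes q: "0 \<le> q" "q \<le> 1" and s: "s \<le> 1 / 4" "0 < s" and G: "1 \<le> G" "G \<le> A\<^sup>2"
    and Y: "\<bar>Y\<bar> \<le> M" and L: "\<bar>L\<bar> \<le> A"
  shows "- (M\<^sup>2 + A) \<le> q * ((1 - 2 * s) * G * a\<^sup>2 - a * Y + L)"
    and "q * ((1 - 2 * s) * G * a\<^sup>2 - a * Y + L) \<le> (A\<^sup>2 + 1) * (q * a\<^sup>2) + M\<^sup>2 + A"
proof -
  have Y2: "Y\<^sup>2 \<le> M\<^sup>2" using Y by (simp add: abs_le_square_iff[symmetric])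
  have "0 \<le> (a - Y)\<^sup>2" "0 \<le> (a + Y)\<^sup>2" by simp_all
  then have aY: "2 * (a * Y) \<le> a\<^sup>2 + Y\<^sup>2" "- (2 * (a * Y)) \<le> a\<^sup>2 + Y\<^sup>2"
    by (simp_all add: power2_eq_square algebra_simps)
  have "1 / 2 * 1 \<le> (1 - 2 * s) * G" using s G by (intro mult_mono) auto
  then have "1 / 2 * a\<^sup>2 \<le> (1 - 2 * s) * G * a\<^sup>2" by (intro mult_right_mono) auto
  then have low: "- (M\<^sup>2 + A) \<le> (1 - 2 * s) * G * a\<^sup>2 - a * Y + L"
    using aY(1) Y2 L zero_le_power2[of Y] by linarith
  have "0 \<le> M\<^sup>2 + A" using L by (simp add: add_nonneg_nonneg order_trans[OF abs_ge_zero])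
  then have "- (M\<^sup>2 + A) \<le> q * - (M\<^sup>2 + A)"
    using mult_right_mono[OF q(2), of "M\<^sup>2 + A"]
    by (simp only: mult_minus_right neg_le_iff_le mult_1_left)
  also have "\<dots> \<le> q * ((1 - 2 * s) * G * a\<^sup>2 - a * Y + L)"
    by (rule mult_left_mono[OF low q(1)])
  finally show "- (M\<^sup>2 + A) \<le> q * ((1 - 2 * s) * G * a\<^sup>2 - a * Y + L)" .
  have "(1 - 2 * s) * G \<le> 1 * A\<^sup>2" using s G by (intro mult_mono) auto
  then have "(1 - 2 * s) * G * a\<^sup>2 \<le> A\<^sup>2 * a\<^sup>2" by (intro mult_right_mono) auto
  then have "(1 - 2 * s) * G * a\<^sup>2 - a * Y + L \<le> (A\<^sup>2 + 1) * a\<^sup>2 + (M\<^sup>2 + A)"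
    using aY(2) Y2 L zero_le_power2[of Y] zero_le_power2[of a] distrib_right[of "A\<^sup>2" 1 "a\<^sup>2"]
    by linarith
  then have "q * ((1 - 2 * s) * G * a\<^sup>2 - a * Y + L) \<le> q * ((A\<^sup>2 + 1) * a\<^sup>2) + q * (M\<^sup>2 + A)"
    using mult_left_mono[OF _ q(1)] by (metis distrib_left)
  also have "q * (M\<^sup>2 + A) \<le> 1 * (M\<^sup>2 + A)"
    by (rule mult_right_mono[OF q(2)]) fact
  finally show "q * ((1 - 2 * s) * G * a\<^sup>2 - a * Y + L) \<le> (A\<^sup>2 + 1) * (q * a\<^sup>2) + M\<^sup>2 + A"
    by (simp add: mult_ac)
qed

text \<open>The asymmetry is the point: the lower bound is uniform in \<open>\<epsilon>\<close>, which handles the negative part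
  of \<open>w\<close>, of which only integrability is known, whereas the upper bound \<open>C / \<epsilon>\<^sup>2\<close> meets only the
  positive part, which is dominated by \<open>u\<close>.\<close>

lemma barrier_laplacian_bounds:
  fixes \<zeta> \<rho> :: "'a::euclidean_space \<Rightarrow> real"
  assumes \<zeta>: "smooth_on \<zeta> UNIV" and \<rho>: "smooth_on \<rho> UNIV" and \<epsilon>: "0 < \<epsilon>" "\<epsilon> \<le> 1"
    and pos: "0 \<le> \<rho> x" "\<rho> x < \<epsilon>" and g: "1 \<le> norm (grad \<rho> x)"
    and A: "norm (grad \<rho> x) \<le> A" "\<bar>laplacian \<rho> x\<bar> \<le> A" "\<bar>\<zeta> x\<bar> \<le> A" "norm (grad \<zeta> x) \<le> A"
      "\<bar>laplacian (\<lambda>x. \<zeta> x * \<zeta> x) x\<bar> \<le> A"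
  defines "C \<equiv> (A\<^sup>2 + 1) * (16 * A\<^sup>2) + (5 * A\<^sup>2)\<^sup>2 + A"
  shows "- C \<le> laplacian (barrier \<zeta> \<rho> \<epsilon>) x" "laplacian (barrier \<zeta> \<rho> \<epsilon>) x \<le> C / \<epsilon>\<^sup>2"
proof -
  define s where "s = 1 / 4 - \<rho> x / (4 * \<epsilon>)"
  define q where "q = exp (- 1 / s)"
  define a where "a = \<zeta> x / (4 * \<epsilon> * s\<^sup>2)"
  define Y where "Y = \<zeta> x * laplacian \<rho> x + 4 * (grad \<zeta> x \<bullet> grad \<rho> x)"
  let ?G = "(norm (grad \<rho> x))\<^sup>2" and ?L = "laplacian (\<lambda>x. \<zeta> x * \<zeta> x) x"
  have s: "0 < s" "s \<le> 1 / 4"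
    using pos \<epsilon> by (auto simp: s_def field_simps)
  have q: "0 \<le> q" "q \<le> 1" using s by (auto simp: q_def)
  have A0: "0 \<le> A" using A(2) by linarith
  have G: "1 \<le> ?G" "?G \<le> A\<^sup>2"
    using g A(1) by (auto intro: power_mono)
  have Y: "\<bar>Y\<bar> \<le> 5 * A\<^sup>2"
  proof -
    have "\<bar>\<zeta> x * laplacian \<rho> x\<bar> \<le> A * A"
      unfolding abs_mult using A A0 by (intro mult_mono) auto
    moreover have "\<bar>grad \<zeta> x \<bullet> grad \<rho> x\<bar> \<le> A * A"
      using order_trans[OF Cauchy_Schwarz_ineq2 mult_mono[OF A(4) A(1)]] A0 by simp
    ultimately show ?thesis unfolding Y_def power2_eq_square by linarith
  qed
  have eq: "laplacian (barrier \<zeta> \<rho> \<epsilon>) x = q * ((1 - 2 * s) * ?G * a\<^sup>2 - a * Y + ?L)"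
    unfolding laplacian_barrier(2)[OF \<zeta> \<rho>] s_def[symmetric] flat_exp_1_derivs flat_exp_1
    using s \<epsilon> by (simp add: a_def Y_def q_def field_simps power2_eq_square power4_eq_xxxx)
  note b = quadratic_bounds[OF q s(2,1) G Y A(5), of a]
  have nn: "0 \<le> (A\<^sup>2 + 1) * (16 * A\<^sup>2)" by simp
  show "- C \<le> laplacian (barrier \<zeta> \<rho> \<epsilon>) x"
    unfolding eq C_def using b(1) nn by linarith
  have "q * a\<^sup>2 \<le> 16 * A\<^sup>2 / \<epsilon>\<^sup>2"
  proof -
    have "q * a\<^sup>2 = (q / s ^ 4) * (\<zeta> x)\<^sup>2 / (16 * \<epsilon>\<^sup>2)"
      by (simp add: a_def power_divide power_mult_distrib)
    also have "\<dots> \<le> 256 * A\<^sup>2 / (16 * \<epsilon>\<^sup>2)"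
      using exp_neg_inverse_le[OF s(1)] s A(3) A0 q
      by (intro divide_right_mono mult_mono) (auto simp: q_def field_simps abs_le_square_iff[symmetric])
    finally show ?thesis by simp
  qed
  then have "(A\<^sup>2 + 1) * (q * a\<^sup>2) \<le> (A\<^sup>2 + 1) * (16 * A\<^sup>2 / \<epsilon>\<^sup>2)"
    by (intro mult_left_mono) auto
  moreover have "(5 * A\<^sup>2)\<^sup>2 + A \<le> ((5 * A\<^sup>2)\<^sup>2 + A) / \<epsilon>\<^sup>2"
    using \<epsilon> A0 by (simp add: le_divide_eq mult_left_le power_le_one)
  ultimately have "(A\<^sup>2 + 1) * (q * a\<^sup>2) + (5 * A\<^sup>2)\<^sup>2 + A \<le> C / \<epsilon>\<^sup>2"
    unfolding C_def add_divide_distrib by simp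
  then show "laplacian (barrier \<zeta> \<rho> \<epsilon>) x \<le> C / \<epsilon>\<^sup>2"
    unfolding eq using b(2) by linarith
qed

lemma barrier_laplacian_eq_0:
  fixes \<zeta> \<rho> :: "'a::euclidean_space \<Rightarrow> real"
  assumes \<zeta>: "smooth_on \<zeta> UNIV" and \<rho>: "smooth_on \<rho> UNIV" and "0 < \<epsilon>" "\<epsilon> \<le> \<rho> x"
  shows "barrier \<zeta> \<rho> \<epsilon> x = 0" "laplacian (barrier \<zeta> \<rho> \<epsilon>) x = 0"
proof -
  have s: "\<not> 0 < 1 / 4 - \<rho> x / (4 * \<epsilon>)" using assms(3,4) by (simp add: field_simps)
  show "barrier \<zeta> \<rho> \<epsilon> x = 0"
    using s by (simp add: barrier_def flat_exp_1)
  show "laplacian (barrier \<zeta> \<rho> \<epsilon>) x = 0"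
    unfolding laplacian_barrier(2)[OF \<zeta> \<rho>] flat_exp_1_derivs flat_exp_1 using s by simp
qed

section \<open>Sign of a density tested against squares\<close>

text \<open>Squares of test functions approximate the indicator of an open set \<open>U \<subseteq> V\<close>, so the positive part
  of \<open>h\<close> has at least as much mass on \<open>U\<close> as the negative part. Both masses are finite Borel
  measures, so by outer regularity the same holds on every Borel subset of \<open>V\<close>, in particular on
  the set where \<open>h\<close> is negative.\<close>

lemma AE_nonneg_if_test_integrals_nonneg:
  fixes h :: "'a::euclidean_space \<Rightarrow> real"
  assumes sets: "sets M = sets (restrict_space borel S)" and S: "closed S"
    and h: "integrable M h" and V: "open V"
    and test: "\<And>\<zeta>. test_function V \<zeta> \<Longrightarrow> 0 \<le> (\<integral>x. (\<zeta> x * \<zeta> x) * h x \<partial>M)"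
  shows "AE x in M. x \<in> V \<longrightarrow> 0 \<le> h x"
proof -
  have space: "space M = S"
    using sets_eq_imp_space_eq[OF sets] by (simp add: space_restrict_space)
  have id[measurable]: "(\<lambda>x. x) \<in> measurable M borel"
    unfolding measurable_cong_sets[OF sets refl] by (rule measurable_restrict_space1) simp
  have hm[measurable]: "h \<in> borel_measurable M" using h by simp
  have bm: "f \<in> borel_measurable M" if "f \<in> borel_measurable borel" for f :: "'a \<Rightarrow> real"
    using measurable_compose[OF id that] by simp
  define N where "N c = distr (density M (\<lambda>x. ennreal (c * h x))) borel (\<lambda>x. x)" for c :: real
  have N: "emeasure (N c) B = (\<integral>\<^sup>+x. ennreal (c * h x) * indicator B x \<partial>M)" if "B \<in> sets borel" for B c
  proof -
    have B: "B \<inter> space M \<in> sets M"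
      using that unfolding sets sets_restrict_space space by (auto simp: Int_commute)
    have "emeasure (N c) B = emeasure (density M (\<lambda>x. ennreal (c * h x))) (B \<inter> space M)"
      unfolding N_def by (subst emeasure_distr) (use that in auto)
    also have "\<dots> = (\<integral>\<^sup>+x. ennreal (c * h x) * indicator (B \<inter> space M) x \<partial>M)"
      by (rule emeasure_density[OF _ B]) simp
    also have "\<dots> = (\<integral>\<^sup>+x. ennreal (c * h x) * indicator B x \<partial>M)"
      by (intro nn_integral_cong) (auto simp: indicator_def)
    finally show ?thesis .
  qed
  have space_N: "space (N c) = UNIV" for c by (simp add: N_def)
  have setsN[simp]: "sets (N c) = sets borel" for c by (simp add: N_def)
  have Nfin: "emeasure (N c) B \<noteq> \<infinity>" if "B \<in> sets borel" for B c
  proof -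
    have "emeasure (N c) B \<le> (\<integral>\<^sup>+x. ennreal (norm (c * h x)) \<partial>M)"
      unfolding N[OF that] by (intro nn_integral_mono) (auto simp: indicator_def intro!: ennreal_leI)
    also have "\<dots> < \<infinity>"
      using integrable_mult_right[of c M h] h unfolding integrable_iff_bounded by blast
    finally show ?thesis by simp
  qed
  have le: "emeasure (N (-1)) U \<le> emeasure (N 1) U" if U: "open U" "U \<subseteq> V" for U
  proof -
    obtain \<theta> :: "nat \<Rightarrow> 'a \<Rightarrow> real" where \<theta>: "\<And>n. test_function U (\<theta> n)"
      "\<And>n x. 0 \<le> \<theta> n x" "\<And>n x. \<theta> n x \<le> 1" "\<And>x. x \<in> U \<Longrightarrow> (\<lambda>n. \<theta> n x) \<longlonglongrightarrow> 1"
      using test_function_exhaustion[OF U(1)] by metis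
    have [measurable]: "\<theta> n \<in> borel_measurable M" for n
      by (intro bm borel_measurable_continuous_onI smooth_on_imp_continuous_on
          test_function_smooth[OF \<theta>(1)])
    have [measurable]: "(\<lambda>x. indicator U x :: real) \<in> borel_measurable M"
      by (intro bm borel_measurable_indicator) (use U in auto)
    have "(\<lambda>n. \<integral>x. (\<theta> n x * \<theta> n x) * h x \<partial>M) \<longlonglongrightarrow> (\<integral>x. indicator U x * h x \<partial>M)"
    proof (rule integral_dominated_convergence)
      show "integrable M (\<lambda>x. norm (h x))" using h by (rule integrable_norm)
      show "AE x in M. (\<lambda>n. (\<theta> n x * \<theta> n x) * h x) \<longlonglongrightarrow> indicator U x * h x"
      proof (intro AE_I2)
        fix x
        show "(\<lambda>n. (\<theta> n x * \<theta> n x) * h x) \<longlonglongrightarrow> indicator U x * h x"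
        proof (cases "x \<in> U")
          case True
          have "(\<lambda>n. (\<theta> n x * \<theta> n x) * h x) \<longlonglongrightarrow> (1 * 1) * h x"
            by (intro tendsto_intros \<theta>(4) True)
          with True show ?thesis by simp
        next
          case False
          then show ?thesis using test_function_eq_0[OF \<theta>(1)] by simp
        qed
      qed
      show "AE x in M. norm ((\<theta> n x * \<theta> n x) * h x) \<le> norm (h x)" for n
        using \<theta>(2,3) by (intro AE_I2) (simp add: abs_mult mult_left_le_one_le mult_le_one)
    qed measurable
    then have nn: "0 \<le> (\<integral>x. indicator U x * h x \<partial>M)"
      by (rule LIMSEQ_le_const) (use test test_function_mono[OF \<theta>(1) U(2)] in auto)
    have iU: "integrable M (\<lambda>x. indicator U x * h x)"
    proof (rule Bochner_Integration.integrable_bound[OF h])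
      show "(\<lambda>x. indicator U x * h x) \<in> borel_measurable M" by measurable
    qed (auto simp: indicator_def)
    have "integrable M (\<lambda>x. max 0 (c * (indicator U x * h x)))" for c
      by (intro integrable_max integrable_mult_right iU) auto
    note iP = this
    have Nint: "emeasure (N c) U = ennreal (\<integral>x. max 0 (c * (indicator U x * h x)) \<partial>M)" for c
      unfolding N[OF borel_open[OF U(1)]]
      by (subst nn_integral_eq_integral[OF iP, symmetric])
        (auto intro!: nn_integral_cong simp: indicator_def max_def ennreal_neg)
    have "(\<integral>x. max 0 (1 * (indicator U x * h x)) \<partial>M) - (\<integral>x. max 0 (-1 * (indicator U x * h x)) \<partial>M)
        = (\<integral>x. indicator U x * h x \<partial>M)"
      by (subst Bochner_Integration.integral_diff[OF iP iP, symmetric])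
        (auto intro!: Bochner_Integration.integral_cong)
    with nn show ?thesis unfolding Nint by (intro ennreal_leI) linarith
  qed
  define A where "A = {x \<in> space M. h x < 0} \<inter> V"
  have "{x \<in> space M. h x < 0} \<in> sets M" by measurable
  then have "{x \<in> space M. h x < 0} \<in> sets borel"
    unfolding sets using S by (auto simp: sets_restrict_space_iff)
  then have A: "A \<in> sets borel" unfolding A_def using V by auto
  have "emeasure (N (-1)) A \<le> (INF U\<in>{U. A \<subseteq> U \<and> open U}. emeasure (N 1) U)"
  proof (rule INF_greatest)
    fix U assume "U \<in> {U. A \<subseteq> U \<and> open U}"
    then have U: "A \<subseteq> U" "open U" by auto
    have "emeasure (N (-1)) A \<le> emeasure (N (-1)) (U \<inter> V)"
      using U V by (intro emeasure_mono) (auto simp: A_def)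
    also have "\<dots> \<le> emeasure (N 1) (U \<inter> V)"
      using U V by (intro le) auto
    also have "\<dots> \<le> emeasure (N 1) U"
      using U V by (intro emeasure_mono) auto
    finally show "emeasure (N (-1)) A \<le> emeasure (N 1) U" .
  qed
  also have "\<dots> = emeasure (N 1) A"
    by (rule outer_regular[symmetric]) (use A Nfin[of UNIV 1] in \<open>auto simp: space_N\<close>)
  also have "\<dots> = (\<integral>\<^sup>+x. 0 \<partial>M)"
    unfolding N[OF A] by (intro nn_integral_cong) (auto simp: A_def indicator_def ennreal_neg)
  finally have "(\<integral>\<^sup>+x. ennreal (-1 * h x) * indicator A x \<partial>M) = 0"
    unfolding N[OF A] by simp
  moreover have "A \<inter> space M \<in> sets M"
      using A unfolding sets sets_restrict_space space by (auto simp: Int_commute)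
  ultimately have "AE x in M. ennreal (-1 * h x) * indicator A x = 0"
    by (subst (asm) nn_integral_0_iff_AE) (auto intro!: borel_measurable_times_ennreal
        borel_measurable_indicator' simp: Int_def conj_commute)
  then show ?thesis
    using AE_space[of M]
    by eventually_elim (auto simp: A_def indicator_def split: if_splits)
qed

section \<open>The local boundary inequality\<close>

lemma infdist_frontier_pos:
  assumes "open \<Omega>" "x \<in> \<Omega>" "frontier \<Omega> \<noteq> {}"
  shows "0 < infdist x (frontier \<Omega>)"
proof -
  have "x \<notin> frontier \<Omega>" using assms by (simp add: frontier_def interior_open)
  then have "infdist x (frontier \<Omega>) \<noteq> 0"
    using assms(3) in_closed_iff_infdist_zero[of "frontier \<Omega>"] by auto
  then show ?thesis using infdist_nonneg[of x "frontier \<Omega>"] by linarith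
qed

text \<open>The segment from \<open>x\<close> to \<open>z\<close> must cross the boundary.\<close>

lemma infdist_frontier_le:
  fixes x z :: "'a::euclidean_space"
  assumes "x \<in> \<Omega>" "z \<notin> \<Omega>"
  shows "infdist x (frontier \<Omega>) \<le> dist x z"
proof -
  have "closed_segment x z \<inter> frontier \<Omega> \<noteq> {}"
    using assms by (intro connected_Int_frontier connected_segment) auto
  then obtain y where y: "y \<in> closed_segment x z" "y \<in> frontier \<Omega>" by auto
  have "infdist x (frontier \<Omega>) \<le> dist x y" by (rule infdist_le[OF y(2)])
  also have "\<dots> \<le> dist x z" using dist_in_closed_segment[OF y(1)] by (simp add: dist_commute)
  finally show ?thesis .
qed

lemma set_integrable_hardy_quotient:
  fixes u :: "'a::euclidean_space \<Rightarrow> real"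
  assumes \<Omega>: "open \<Omega>" and u: "set_integrable lebesgue \<Omega> u" and nn: "AE x in lebesgue. x \<in> \<Omega> \<longrightarrow> 0 \<le> u x"
    and fin: "(\<integral>\<^sup>+x\<in>\<Omega>. ennreal (u x / (infdist x (frontier \<Omega>))\<^sup>2) \<partial>lebesgue) < \<infinity>"
  shows "set_integrable lebesgue \<Omega> (\<lambda>x. u x / (infdist x (frontier \<Omega>))\<^sup>2)"
  unfolding set_integrable_def integrable_iff_bounded
proof
  have "(\<lambda>x. infdist x (frontier \<Omega>)) \<in> borel_measurable lebesgue"
    by (rule measurable_completion) (simp add: borel_measurable_continuous_onI continuous_on_infdist)
  then have "(\<lambda>x. (indicator \<Omega> x *\<^sub>R u x) / (infdist x (frontier \<Omega>))\<^sup>2) \<in> borel_measurable lebesgue"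
    using borel_measurable_integrable[OF u[unfolded set_integrable_def]]
    by (intro borel_measurable_divide borel_measurable_power)
  then show "(\<lambda>x. indicator \<Omega> x *\<^sub>R (u x / (infdist x (frontier \<Omega>))\<^sup>2)) \<in> borel_measurable lebesgue"
    by simp
  have "(\<integral>\<^sup>+ x. ennreal (norm (indicator \<Omega> x *\<^sub>R (u x / (infdist x (frontier \<Omega>))\<^sup>2))) \<partial>lebesgue)
      = (\<integral>\<^sup>+x\<in>\<Omega>. ennreal (u x / (infdist x (frontier \<Omega>))\<^sup>2) \<partial>lebesgue)"
    by (rule nn_integral_cong_AE) (use nn in \<open>eventually_elim, auto simp: indicator_def\<close>)
  with fin show "(\<integral>\<^sup>+ x. ennreal (norm (indicator \<Omega> x *\<^sub>R (u x / (infdist x (frontier \<Omega>))\<^sup>2))) \<partial>lebesgue) < \<infinity>"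
    by simp
qed

text \<open>The pairing with the barrier \<open>\<psi>\<close> is a constant multiple of the pairing with \<open>\<zeta>\<^sup>2\<close>, because \<open>\<rho> = 0\<close> on
  the boundary. It equals \<open>- \<integral> w \<Delta>\<psi>\<close> plus the integral of \<open>\<psi>\<close> against the measure \<open>\<Delta>w\<close>. The latter
  vanishes in the limit since \<open>\<psi>\<close> tends to zero at every point of \<open>\<Omega>\<close>. For the former,
  \<open>w \<Delta>\<psi> \<le> C (u / d\<^sup>2 + \<bar>w\<bar>)\<close> on a layer of width \<open>\<epsilon>\<close>, with \<open>d\<close> the distance to the boundary, and
  \<open>\<Delta>\<psi> = 0\<close> on the rest of \<open>\<Omega>\<close>; the integral over the shrinking layer tends to zero because
  \<open>u / d\<^sup>2\<close> and \<open>w\<close> are integrable.\<close>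

lemma boundary_pairing_nonneg:
  fixes \<Omega> :: "'a::euclidean_space set" and u w h \<gamma> \<zeta> :: "'a \<Rightarrow> real"
  assumes \<Omega>: "open \<Omega>" "bounded \<Omega>" and p: "p \<in> frontier \<Omega>" and r: "0 < r"
    and e: "norm e = 1" and \<gamma>: "smooth_on \<gamma> UNIV"
    and graph: "\<Omega> \<inter> ball p r = {x \<in> ball p r. \<gamma> (x - (x \<bullet> e) *\<^sub>R e) < x \<bullet> e}"
    and u: "set_integrable lebesgue \<Omega> u" and u0: "AE x in lebesgue. x \<in> \<Omega> \<longrightarrow> 0 \<le> u x"
    and fin: "(\<integral>\<^sup>+x\<in>\<Omega>. ennreal (u x / (infdist x (frontier \<Omega>))\<^sup>2) \<partial>lebesgue) < \<infinity>"
    and w: "has_normal_derivative \<Omega> w h" and wu: "AE x in lebesgue. x \<in> \<Omega> \<longrightarrow> w x \<le> u x"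
    and \<zeta>: "test_function (ball p (r / 2)) \<zeta>"
  shows "0 \<le> (\<integral>x. (\<zeta> x * \<zeta> x) * h x \<partial>surface_measure \<Omega>)"
proof -
  let ?\<rho> = "graph_height e \<gamma>" and ?d = "\<lambda>x. infdist x (frontier \<Omega>)"
  define c where "c = flat_exp 1 (1 / 4)"
  have c: "0 < c" by (simp add: c_def flat_exp_1)
  have s\<zeta>: "smooth_on \<zeta> UNIV" by (rule test_function_smooth[OF \<zeta>])
  have s\<rho>: "smooth_on ?\<rho> UNIV" by (rule smooth_on_graph_height[OF \<gamma>])
  from w obtain g \<mu> \<nu> where wW: "w \<in> W011 \<Omega>" and g: "W11_gradient \<Omega> w g"
    and L: "laplacian_measure \<Omega> w \<mu> \<nu>"
    and id: "\<And>\<psi>. smooth_on \<psi> UNIV \<Longrightarrow> (LINT x:\<Omega>|lebesgue. g x \<bullet> grad \<psi> x) =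
        - ((LINT x|\<mu>. \<psi> x) - (LINT x|\<nu>. \<psi> x)) + (LINT x|surface_measure \<Omega>. \<psi> x * h x)"
    unfolding has_normal_derivative_def by blast
  have wi: "set_integrable lebesgue \<Omega> w" using g by (simp add: W11_gradient_def)
  define U where "U x = u x / (?d x)\<^sup>2" for x
  have Ui: "set_integrable lebesgue \<Omega> U"
    unfolding U_def [abs_def] by (rule set_integrable_hardy_quotient[OF \<Omega>(1) u u0 fin])
  have mem: "x \<in> \<Omega> \<longleftrightarrow> 0 < ?\<rho> x" if "x \<in> ball p r" for x
  proof -
    have "x \<in> \<Omega> \<longleftrightarrow> x \<in> \<Omega> \<inter> ball p r" using that by simp
    then show ?thesis unfolding graph using that by (simp add: graph_height_def)
  qed
  have sub: "ball p (r / 2) \<subseteq> ball p r" using r by (intro subset_ball) auto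
  have \<rho>0: "?\<rho> x = 0" if "x \<in> frontier \<Omega>" "x \<in> ball p r" for x
  proof -
    have "x \<notin> \<Omega>" using that \<Omega>(1) by (simp add: frontier_def interior_open)
    then have "?\<rho> x \<le> 0" using mem[OF that(2)] by simp
    moreover have "0 \<le> ?\<rho> x"
    proof -
      have "x \<in> closure (\<Omega> \<inter> ball p r)"
        using that open_Int_closure_subset[of "ball p r" \<Omega>] by (auto simp: frontier_def Int_commute)
      also have "\<dots> \<subseteq> {x. 0 \<le> ?\<rho> x}"
        using mem smooth_on_imp_continuous_on[OF s\<rho>]
        by (intro closure_minimal closed_Collect_le continuous_on_const) (auto intro: less_imp_le)
      finally show ?thesis by simp
    qed
    ultimately show ?thesis by simp
  qed
  \<comment> \<open>Descending from \<open>x\<close> along \<open>- e\<close> leaves \<open>\<Omega>\<close> at height zero; staying within half the radius keeps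
    the whole descent inside the chart.\<close>
  have dist_le: "?d x \<le> ?\<rho> x" if x: "x \<in> \<Omega>" "x \<in> ball p (r / 2)" and "?\<rho> x < r / 2" for x
  proof -
    have pos: "0 < ?\<rho> x" using mem[of x] x sub by auto
    let ?z = "x - ?\<rho> x *\<^sub>R e"
    have xz: "dist x ?z = ?\<rho> x" using e pos by (simp add: dist_norm)
    then have "?z \<in> ball p r"
      using x that(3) dist_triangle[of p ?z x] by simp
    then have "?z \<notin> \<Omega>" by (simp add: mem graph_height_shift[OF e])
    then show ?thesis using infdist_frontier_le[OF x(1)] xz by metis
  qed
  have bd: "\<exists>B. \<forall>x\<in>ball p r. norm (f x) \<le> B" if "continuous_on UNIV f" for f :: "'a \<Rightarrow> 'c::real_normed_vector"
    using bounded_on_bounded[OF that bounded_ball] by metis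
  obtain A1 where A1: "\<forall>x\<in>ball p r. norm (grad ?\<rho> x) \<le> A1"
    using bd[OF continuous_on_grad[OF s\<rho>]] by blast
  obtain A2 where A2: "\<forall>x\<in>ball p r. norm (laplacian ?\<rho> x) \<le> A2"
    using bd[OF smooth_on_imp_continuous_on[OF smooth_on_laplacian[OF s\<rho>]]] by blast
  obtain A3 where A3: "\<forall>x\<in>ball p r. norm (\<zeta> x) \<le> A3"
    using bd[OF smooth_on_imp_continuous_on[OF s\<zeta>]] by blast
  obtain A4 where A4: "\<forall>x\<in>ball p r. norm (grad \<zeta> x) \<le> A4"
    using bd[OF continuous_on_grad[OF s\<zeta>]] by blast
  obtain A5 where A5: "\<forall>x\<in>ball p r. norm (laplacian (\<lambda>x. \<zeta> x * \<zeta> x) x) \<le> A5"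
    using bd[OF smooth_on_imp_continuous_on[OF smooth_on_laplacian[OF smooth_on_mult[OF s\<zeta> s\<zeta>]]]] by blast
  define A where "A = max A1 (max A2 (max A3 (max A4 A5)))"
  have A: "norm (grad ?\<rho> x) \<le> A" "\<bar>laplacian ?\<rho> x\<bar> \<le> A" "\<bar>\<zeta> x\<bar> \<le> A" "norm (grad \<zeta> x) \<le> A"
      "\<bar>laplacian (\<lambda>x. \<zeta> x * \<zeta> x) x\<bar> \<le> A" if "x \<in> ball p r" for x
    using A1 A2 A3 A4 A5 that unfolding A_def by (auto simp: le_max_iff_disj)
  define C where "C = (A\<^sup>2 + 1) * (16 * A\<^sup>2) + (5 * A\<^sup>2)\<^sup>2 + A"
  have "0 \<le> A" using A(1)[of p] r by (simp add: order_trans[OF norm_ge_zero])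
  then have C: "0 \<le> C" by (simp add: C_def)
  \<comment> \<open>At most \<open>1\<close> for the bounds on the Laplacian, at most \<open>r / 2\<close> so that the layer stays in the chart.\<close>
  define \<epsilon> where "\<epsilon> n = min 1 (r / 2) / real (Suc n)" for n
  have \<epsilon>: "0 < \<epsilon> n" "\<epsilon> n \<le> 1" "\<epsilon> n \<le> r / 2" for n
  proof -
    show "0 < \<epsilon> n" using r by (simp add: \<epsilon>_def)
    have "min 1 (r / 2) / real (Suc n) \<le> min 1 (r / 2) / 1"
      using r by (intro divide_left_mono) auto
    then have "\<epsilon> n \<le> min 1 (r / 2)" by (simp add: \<epsilon>_def)
    then show "\<epsilon> n \<le> 1" "\<epsilon> n \<le> r / 2" by auto
  qed
  have \<epsilon>_lim: "\<epsilon> \<longlonglongrightarrow> 0"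
    unfolding \<epsilon>_def [abs_def] by (intro LIMSEQ_Suc[OF lim_const_over_n])
  have \<epsilon>_small: "\<forall>\<^sub>F n in sequentially. \<epsilon> n \<le> t" if "0 < t" for t
    using order_tendstoD(2)[OF \<epsilon>_lim that] by (auto elim: eventually_mono)
  let ?\<psi> = "\<lambda>n. barrier \<zeta> ?\<rho> (\<epsilon> n)"
  have s\<psi>: "smooth_on (?\<psi> n) UNIV" for n by (rule laplacian_barrier(1)[OF s\<zeta> s\<rho>])
  have \<zeta>0: "\<zeta> x = 0" if "x \<notin> ball p (r / 2)" for x by (rule test_function_eq_0[OF \<zeta> that])
  have \<psi>_test: "test_function (ball p (r / 2)) (?\<psi> n)" for n
  proof -
    have "smooth_on (\<lambda>x. flat_exp 1 (1 / 4 - ?\<rho> x * (1 / (4 * \<epsilon> n)))) UNIV"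
      by (intro smooth_on_compose_real[OF smooth_on_flat_exp] smooth_on_diff smooth_on_mult[OF s\<rho>]
          smooth_on_const)
    from test_function_mult[OF test_function_mult[OF \<zeta> s\<zeta>] this]
    show ?thesis by (simp add: barrier_def [abs_def])
  qed
  have lap0: "laplacian (?\<psi> n) x = 0" if "x \<notin> ball p (r / 2)" for n x
    using test_function_eq_0[OF test_function_derivative[OF test_function_derivative[OF \<psi>_test]] that]
    by (simp add: laplacian_def)
  \<comment> \<open>Inside \<open>\<Omega>\<close> this is the layer on which the barrier lives.\<close>
  define S where "S n = {x \<in> ball p (r / 2). ?\<rho> x < \<epsilon> n}" for n
  have pointwise: "w x * laplacian (?\<psi> n) x \<le> C * (U x + \<bar>w x\<bar>) * indicator (S n) x"
    if x: "x \<in> \<Omega>" and ux: "0 \<le> u x" and wx: "w x \<le> u x" for n x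
  proof (cases "x \<in> S n")
    case True
    then have xb: "x \<in> ball p (r / 2)" and small: "?\<rho> x < \<epsilon> n" by (auto simp: S_def)
    then have xr: "x \<in> ball p r" using sub by auto
    have pos: "0 < ?\<rho> x" using mem[OF xr] x by simp
    note b = barrier_laplacian_bounds[OF s\<zeta> s\<rho> \<epsilon>(1,2) less_imp_le[OF pos] small
        norm_grad_graph_height[OF e \<gamma>] A[OF xr], folded C_def]
    have U0: "0 \<le> U x" using ux by (simp add: U_def)
    show ?thesis
    proof (cases "0 \<le> w x")
      case True
      \<comment> \<open>Positivity matters: a quotient by \<open>d = 0\<close> would be zero and could not dominate anything.\<close>
      have d: "0 < ?d x" "?d x \<le> \<epsilon> n"
        using infdist_frontier_pos[OF \<Omega>(1) x] p dist_le[OF x xb] small \<epsilon>(3)[of n] by auto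
      have "w x * laplacian (?\<psi> n) x \<le> u x * (C / (\<epsilon> n)\<^sup>2)"
        using mult_left_mono[OF b(2) True] mult_right_mono[OF wx, of "C / (\<epsilon> n)\<^sup>2"] C by simp
      also have "\<dots> \<le> u x * (C / (?d x)\<^sup>2)"
        using d C ux by (intro mult_left_mono divide_left_mono power_mono) auto
      also have "\<dots> = C * U x" by (simp add: U_def)
      also have "\<dots> \<le> C * (U x + \<bar>w x\<bar>)" using C by (intro mult_left_mono) auto
      finally show ?thesis using \<open>x \<in> S n\<close> by simp
    next
      case False
      then have "w x * laplacian (?\<psi> n) x \<le> w x * - C"
        using b(1) by (intro mult_left_mono_neg) auto
      also have "\<dots> = C * \<bar>w x\<bar>" using False by simp
      also have "\<dots> \<le> C * (U x + \<bar>w x\<bar>)" using C U0 by (intro mult_left_mono) auto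
      finally show ?thesis using \<open>x \<in> S n\<close> by simp
    qed
  next
    case False
    have "laplacian (?\<psi> n) x = 0"
    proof (cases "x \<in> ball p (r / 2)")
      case True
      with False have "\<epsilon> n \<le> ?\<rho> x" by (simp add: S_def)
      then show ?thesis by (rule barrier_laplacian_eq_0[OF s\<zeta> s\<rho> \<epsilon>(1)])
    qed (rule lap0)
    with False show ?thesis by simp
  qed
  define D where "D n = (LINT x:\<Omega>|lebesgue. C * (U x + \<bar>w x\<bar>) * indicator (S n) x)" for n
  have CU: "integrable lebesgue (\<lambda>x. indicator \<Omega> x *\<^sub>R (C * (U x + \<bar>w x\<bar>)))"
    using set_integrable_mult_right[OF set_integral_add(1)[OF Ui set_integrable_abs[OF wi]], of C]
    by (simp add: set_integrable_def)
  have S_meas[measurable]: "S n \<in> sets lebesgue" for n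
  proof -
    have "open (ball p (r / 2) \<inter> {x. ?\<rho> x < \<epsilon> n})"
      by (intro open_Int open_ball open_Collect_less continuous_on_const smooth_on_imp_continuous_on s\<rho>)
    also have "ball p (r / 2) \<inter> {x. ?\<rho> x < \<epsilon> n} = S n" by (auto simp: S_def)
    finally show ?thesis by simp
  qed
  have indS: "(\<lambda>x. indicator (S n) x :: real) \<in> borel_measurable lebesgue" for n by measurable
  have meas: "(\<lambda>x. indicator \<Omega> x *\<^sub>R (C * (U x + \<bar>w x\<bar>) * indicator (S n) x)) \<in> borel_measurable lebesgue" for n
    using borel_measurable_times[OF borel_measurable_integrable[OF CU] indS[of n]] by (simp add: mult.assoc)
  have D_int: "set_integrable lebesgue \<Omega> (\<lambda>x. C * (U x + \<bar>w x\<bar>) * indicator (S n) x)" for n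
    unfolding set_integrable_def
    by (rule Bochner_Integration.integrable_bound[OF CU meas]) (auto simp: indicator_def)
  have D_lim: "D \<longlonglongrightarrow> 0"
  proof -
    have "D \<longlonglongrightarrow> (LINT x:\<Omega>|lebesgue. 0)"
      unfolding D_def [abs_def] set_lebesgue_integral_def
    proof (rule integral_dominated_convergence[OF _ meas integrable_norm[OF CU]])
      show "AE x in lebesgue. (\<lambda>n. indicator \<Omega> x *\<^sub>R (C * (U x + \<bar>w x\<bar>) * indicator (S n) x))
          \<longlonglongrightarrow> indicator \<Omega> x *\<^sub>R 0"
      proof (intro AE_I2)
        fix x
        have "\<forall>\<^sub>F n in sequentially. indicator \<Omega> x *\<^sub>R (C * (U x + \<bar>w x\<bar>) * indicator (S n) x) = indicator \<Omega> x *\<^sub>R 0"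
        proof (cases "x \<in> \<Omega> \<and> x \<in> ball p (r / 2)")
          case True
          then have "0 < ?\<rho> x" using mem[of x] sub by auto
          from \<epsilon>_small[OF this] show ?thesis
            by eventually_elim (auto simp: S_def)
        next
          case False
          then show ?thesis by (auto simp: S_def)
        qed
        then show "(\<lambda>n. indicator \<Omega> x *\<^sub>R (C * (U x + \<bar>w x\<bar>) * indicator (S n) x)) \<longlonglongrightarrow> indicator \<Omega> x *\<^sub>R 0"
          by (rule tendsto_eventually)
      qed
    qed (auto simp: indicator_def)
    then show ?thesis by (simp add: set_lebesgue_integral_def)
  qed
  have green: "- D n \<le> (LINT x:\<Omega>|lebesgue. g x \<bullet> grad (?\<psi> n) x)" for n
  proof -
    have cl: "continuous_on UNIV (laplacian (?\<psi> n))"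
      by (rule smooth_on_imp_continuous_on[OF smooth_on_laplacian[OF s\<psi>]])
    obtain B where "\<And>x. x \<in> \<Omega> \<Longrightarrow> norm (laplacian (?\<psi> n) x) \<le> B"
      using bounded_on_bounded[OF cl \<Omega>(2)] by metis
    from set_integrable_inner_bounded[OF wi cl this]
    have "set_integrable lebesgue \<Omega> (\<lambda>x. w x * laplacian (?\<psi> n) x)" by simp
    then have "(LINT x:\<Omega>|lebesgue. w x * laplacian (?\<psi> n) x) \<le> D n"
      unfolding D_def using u0 wu pointwise
      by (intro set_integral_mono_AE D_int) (auto elim!: eventually_elim2)
    then show ?thesis
      using W011_green[OF \<Omega> wW g s\<psi>] by simp
  qed
  \<comment> \<open>Applied below to the two parts of the measure \<open>\<Delta>w\<close>.\<close>
  have vanish: "(\<lambda>n. LINT x|m. ?\<psi> n x) \<longlonglongrightarrow> 0"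
    if m: "finite_measure m" "sets m = sets (restrict_space borel \<Omega>)" for m
  proof -
    interpret finite_measure m by fact
    have sp: "space m = \<Omega>"
      using sets_eq_imp_space_eq[OF m(2)] by (simp add: space_restrict_space)
    obtain B where B: "\<And>x. \<bar>\<zeta> x * \<zeta> x\<bar> \<le> B"
      using test_function_bounded[OF test_function_mult[OF \<zeta> s\<zeta>]] by metis
    have "(\<lambda>n. LINT x|m. ?\<psi> n x) \<longlonglongrightarrow> (LINT x|m. 0)"
    proof (rule integral_dominated_convergence[where w = "\<lambda>_. B"])
      show "?\<psi> n \<in> borel_measurable m" for n
        unfolding measurable_cong_sets[OF m(2) refl]
        by (intro measurable_restrict_space1 borel_measurable_continuous_onI
            smooth_on_imp_continuous_on s\<psi>)
      show "AE x in m. (\<lambda>n. ?\<psi> n x) \<longlonglongrightarrow> 0"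
      proof (intro AE_I2)
        fix x assume "x \<in> space m"
        then have x: "x \<in> \<Omega>" using sp by simp
        have "\<forall>\<^sub>F n in sequentially. ?\<psi> n x = 0"
        proof (cases "x \<in> ball p (r / 2)")
          case True
          then have "0 < ?\<rho> x" using mem[of x] sub x by auto
          from \<epsilon>_small[OF this] show ?thesis
            by eventually_elim (rule barrier_laplacian_eq_0(1)[OF s\<zeta> s\<rho> \<epsilon>(1)])
        next
          case False
          then show ?thesis by (simp add: barrier_def \<zeta>0)
        qed
        then show "(\<lambda>n. ?\<psi> n x) \<longlonglongrightarrow> 0" by (rule tendsto_eventually)
      qed
      show "AE x in m. norm (?\<psi> n x) \<le> B" for n
      proof (intro AE_I2)
        fix x
        have "norm (?\<psi> n x) \<le> \<bar>\<zeta> x * \<zeta> x\<bar> * 1"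
          unfolding barrier_def real_norm_def abs_mult[of "_ * _"]
          by (intro mult_left_mono) (simp_all add: flat_exp_1_bounds)
        with B[of x] show "norm (?\<psi> n x) \<le> B" by simp
      qed
    qed auto
    then show ?thesis by simp
  qed
  have \<sigma>: "(LINT x|surface_measure \<Omega>. ?\<psi> n x * h x)
      = c * (\<integral>x. (\<zeta> x * \<zeta> x) * h x \<partial>surface_measure \<Omega>)" for n
  proof -
    have "?\<psi> n x * h x = c * ((\<zeta> x * \<zeta> x) * h x)" if "x \<in> frontier \<Omega>" for x
      using \<rho>0[OF that] \<zeta>0[of x] sub by (cases "x \<in> ball p (r / 2)") (auto simp: barrier_def c_def)
    then have "(LINT x|surface_measure \<Omega>. ?\<psi> n x * h x)
        = (LINT x|surface_measure \<Omega>. c * ((\<zeta> x * \<zeta> x) * h x))"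
      by (intro Bochner_Integration.integral_cong refl)
        (auto simp: surface_measure_def space_restrict_space)
    then show ?thesis by simp
  qed
  have "- D n + ((LINT x|\<mu>. ?\<psi> n x) - (LINT x|\<nu>. ?\<psi> n x))
      \<le> c * (\<integral>x. (\<zeta> x * \<zeta> x) * h x \<partial>surface_measure \<Omega>)" for n
    using green[of n] id[OF s\<psi>[of n]] \<sigma>[of n] by linarith
  moreover have "(\<lambda>n. - D n + ((LINT x|\<mu>. ?\<psi> n x) - (LINT x|\<nu>. ?\<psi> n x))) \<longlonglongrightarrow> - 0 + (0 - 0)"
    using L unfolding laplacian_measure_def by (intro tendsto_intros D_lim vanish) auto
  ultimately have "- 0 + (0 - 0) \<le> c * (\<integral>x. (\<zeta> x * \<zeta> x) * h x \<partial>surface_measure \<Omega>)"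
    by (intro LIMSEQ_le_const2) auto
  then show ?thesis using c by (simp add: zero_le_mult_iff)
qed

lemma sets_surface_measure: "sets (surface_measure \<Omega>) = sets (restrict_space borel (frontier \<Omega>))"
  unfolding surface_measure_def by (intro sets_restrict_space_cong) simp

text \<open>The local sign is transported to the whole boundary by compactness.\<close>

lemma normal_derivative_of_minorant_nonneg:
  fixes \<Omega> :: "'a::euclidean_space set"
  assumes \<Omega>: "open \<Omega>" "bounded \<Omega>" and smooth: "smooth_boundary \<Omega>"
    and u: "set_integrable lebesgue \<Omega> u" and u0: "AE x in lebesgue. x \<in> \<Omega> \<longrightarrow> 0 \<le> u x"
    and fin: "(\<integral>\<^sup>+x\<in>\<Omega>. ennreal (u x / (infdist x (frontier \<Omega>))\<^sup>2) \<partial>lebesgue) < \<infinity>"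
    and w: "has_normal_derivative \<Omega> w h" and wu: "AE x in lebesgue. x \<in> \<Omega> \<longrightarrow> w x \<le> u x"
  shows "AE x in surface_measure \<Omega>. 0 \<le> h x"
proof -
  have h: "integrable (surface_measure \<Omega>) h" using w by (simp add: has_normal_derivative_def)
  have "\<exists>s>0. AE x in surface_measure \<Omega>. x \<in> ball p s \<longrightarrow> 0 \<le> h x" if p: "p \<in> frontier \<Omega>" for p
  proof -
    obtain r e and \<gamma> :: "'a \<Rightarrow> real" where r: "0 < r" and e: "norm e = 1" and \<gamma>: "smooth_on \<gamma> UNIV"
      and graph: "\<Omega> \<inter> ball p r = {x \<in> ball p r. \<gamma> (x - (x \<bullet> e) *\<^sub>R e) < x \<bullet> e}"
      using smooth p unfolding smooth_boundary_def by blast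
    have "AE x in surface_measure \<Omega>. x \<in> ball p (r / 2) \<longrightarrow> 0 \<le> h x"
      by (rule AE_nonneg_if_test_integrals_nonneg[OF sets_surface_measure frontier_closed h open_ball])
        (rule boundary_pairing_nonneg[OF \<Omega> p r e \<gamma> graph u u0 fin w wu])
    with r show ?thesis by (intro exI[of _ "r / 2"]) auto
  qed
  then obtain s where s: "\<And>p. p \<in> frontier \<Omega> \<Longrightarrow> 0 < s p"
    "\<And>p. p \<in> frontier \<Omega> \<Longrightarrow> AE x in surface_measure \<Omega>. x \<in> ball p (s p) \<longrightarrow> 0 \<le> h x"
    by metis
  have "compact (frontier \<Omega>)" using \<Omega>(2) by (rule compact_frontier_bounded)
  moreover have "frontier \<Omega> \<subseteq> (\<Union>p\<in>frontier \<Omega>. ball p (s p))" using s(1) by force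
  ultimately obtain T where T: "T \<subseteq> frontier \<Omega>" "finite T" "frontier \<Omega> \<subseteq> (\<Union>p\<in>T. ball p (s p))"
    using compactE_image[of "frontier \<Omega>" "frontier \<Omega>" "\<lambda>p. ball p (s p)"] open_ball by metis
  have "AE x in surface_measure \<Omega>. \<forall>p\<in>T. x \<in> ball p (s p) \<longrightarrow> 0 \<le> h x"
    using T s(2) by (intro AE_finite_allI) auto
  then show ?thesis
    using AE_space
    by eventually_elim (use T(3) in \<open>auto simp: surface_measure_def space_restrict_space\<close>)
qed

section \<open>Comparison with the zero function\<close>

lemma has_normal_derivative_0:
  fixes \<Omega> :: "'a::euclidean_space set"
  shows "has_normal_derivative \<Omega> (\<lambda>_. 0) (\<lambda>_. 0)"
    and "laplacian_measure \<Omega> (\<lambda>_. 0) (null_measure (restrict_space borel \<Omega>)) (null_measure (restrict_space borel \<Omega>))"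
proof -
  let ?N = "null_measure (restrict_space borel \<Omega>) :: 'a measure"
  have fin: "finite_measure ?N" by (rule finite_measureI) simp
  show L: "laplacian_measure \<Omega> (\<lambda>_. 0) ?N ?N"
    by (simp add: laplacian_measure_def fin)
  have G: "W11_gradient \<Omega> (\<lambda>_. 0) (\<lambda>_. 0)"
    by (simp add: W11_gradient_def has_weak_gradient_def set_integrable_def)
  have "grad (\<lambda>_. 0 :: real) = (\<lambda>_::'a. 0)"
    by (intro ext) (simp add: grad_def)
  then have "(\<lambda>_. 0) \<in> W011 \<Omega>"
    unfolding W011_def by (auto intro!: exI[of _ "\<lambda>_. 0"] exI[of _ "\<lambda>_ _. 0"] G)
  with L G show "has_normal_derivative \<Omega> (\<lambda>_. 0) (\<lambda>_. 0)"
    unfolding has_normal_derivative_def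
    by (auto intro!: exI[of _ "\<lambda>_. 0"] exI[of _ ?N])
qed

theorem proposition2p7:
  fixes \<Omega> :: "'a::euclidean_space set" and u :: "'a \<Rightarrow> real"
  assumes "open \<Omega>" and "bounded \<Omega>" and "connected \<Omega>" and "smooth_boundary \<Omega>"
    and "u \<in> W011 \<Omega>"
    and "AE x in lebesgue. x \<in> \<Omega> \<longrightarrow> 0 \<le> u x"
    and "(\<integral>\<^sup>+x\<in>\<Omega>. ennreal (u x / (infdist x (frontier \<Omega>))\<^sup>2) \<partial>lebesgue) < \<infinity>"
  shows "AE x in surface_measure \<Omega>. normal_derivative \<Omega> u x = 0"
proof -
  have u: "set_integrable lebesgue \<Omega> u"
    using assms(5) by (auto simp: W011_def W11_gradient_def)
  have zero: "(\<lambda>_. 0) \<in> minorants \<Omega> u"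
    unfolding minorants_def
    using has_normal_derivative_0[of \<Omega>] assms(6) by (auto simp: has_normal_derivative_def)
  have "is_ess_normal_derivative \<Omega> u (\<lambda>_. 0)"
    unfolding is_ess_normal_derivative_def
  proof (intro conjI allI impI)
    show "lower_bound_of_normal_derivatives \<Omega> u (\<lambda>_. 0)"
      unfolding lower_bound_of_normal_derivatives_def
      using normal_derivative_of_minorant_nonneg[OF assms(1,2,4) u assms(6,7)]
      by (auto simp: minorants_def)
  next
    fix F assume "lower_bound_of_normal_derivatives \<Omega> u F"
    then have "AE x in surface_measure \<Omega>. F x \<le> ereal 0"
      using zero has_normal_derivative_0(1) unfolding lower_bound_of_normal_derivatives_def by blast
    then show "AE x in surface_measure \<Omega>. F x \<le> 0" by (simp add: zero_ereal_def)
  qed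
  from normal_derivative_AE_eq[OF this] show ?thesis .
qed

end
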